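(* Let $k\ge 2$, $l\le k-1$ and $m\ge 1$ be integers, and let the sequence $(c_n)_{n\ge 1}$ be defined by $c_1=4l$ and $c_n=4(c_{n-1}-1)$ for all $n\ge 2$. Let $X$ be a non trivial real polynomial Hamiltonian vector field of the form $$X=X_{lin}+X_k+X_{k+1}+\dots+X_{2l}+\sum_{n=1}^{m}\ \sum_{j=c_n}^{2(c_n-1)}X_{j}.$$ Then $X$ is nonisochronous.
   Context: Planar real vector fields are written in complex form: $\mathbb{R}^2$ is identified with $\mathbb{C}$ by the complex coordinate $x$, with conjugate $\bar x$. Set $X_{lin}=i(x\partial_x-\bar x\partial_{\bar x})$ and, for $r\ge 2$, $X_r=P_r(x,\bar x)\partial_x+\overline{P_r(x,\bar x)}\,\partial_{\bar x}$, where $P_r(x,\bar x)=\sum_{j=0}^{r}p_{r-j-1,j}\,x^{r-j}\bar x^{j}$ is homogeneous of degree $r$ with complex coefficients. The field is real Hamiltonian if, in real coordinates $x=u+iv$, it is of the form $-\partial_vH\,\partial_u+\partial_uH\,\partial_v$ for a real polynomial $H(u,v)$. Non trivial means that $X\ne X_{lin}$. The origin is then a center. It is isochronous if all periodic orbits in a neighbourhood of the origin have the same period, and $X$ is called nonisochronous if its center at the origin is not isochronous. *)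

theory Defs
  imports "HOL-Analysis.Analysis"
begin

text \<open>
  A planar real vector field \<open>P \<partial>\<^sub>x + cnj P \<partial>\<^bsub>cnj x\<^esub>\<close> is represented by its first component
  \<open>P\<close>, seen as a function of the point \<open>x\<close>; its orbits are the solutions of \<open>x' = P x\<close>,
  the second component being the conjugate of this equation.
\<close>

definition lin_field :: "complex \<Rightarrow> complex" where
  "lin_field x = \<i> * x"

text \<open>
  The coefficient of \<open>x\<^sup>a\<^sup>+\<^sup>1 (cnj x)\<^sup>j\<close> is \<open>p a j\<close>; the first index can be \<open>-1\<close>.
\<close>

definition hom_field :: "(int \<Rightarrow> nat \<Rightarrow> complex) \<Rightarrow> nat \<Rightarrow> complex \<Rightarrow> complex" where
  "hom_field p r x = (\<Sum>j=0..r. p (int r - int j - 1) j * x ^ (r - j) * cnj x ^ j)"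

definition real_hamiltonian :: "(complex \<Rightarrow> complex) \<Rightarrow> bool" where
  "real_hamiltonian X \<longleftrightarrow>
     (\<exists>H :: real \<times> real \<Rightarrow> real. real_polynomial_function H \<and>
        (\<forall>u v. X (Complex u v) =
           Complex (- deriv (\<lambda>s. H (u, s)) v) (deriv (\<lambda>s. H (s, v)) u)))"

definition solution :: "(complex \<Rightarrow> complex) \<Rightarrow> (real \<Rightarrow> complex) \<Rightarrow> bool" where
  "solution X \<gamma> \<longleftrightarrow> (\<forall>t. (\<gamma> has_vector_derivative X (\<gamma> t)) (at t))"

text \<open>
  \<open>T\<close> is the least positive period of \<open>\<gamma>\<close>. Constant solutions have no least positive
  period, so equilibria do not count as periodic orbits.
\<close>

definition periodic_solution ::
    "(complex \<Rightarrow> complex) \<Rightarrow> (real \<Rightarrow> complex) \<Rightarrow> real \<Rightarrow> bool" where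
  "periodic_solution X \<gamma> T \<longleftrightarrow>
     solution X \<gamma> \<and> T > 0 \<and> (\<forall>t. \<gamma> (t + T) = \<gamma> t) \<and>
     (\<forall>s. 0 < s \<and> s < T \<longrightarrow> (\<exists>t. \<gamma> (t + s) \<noteq> \<gamma> t))"

text \<open>
  That the origin is a center is not part of the definition. The negation is therefore
  not satisfied merely because periodic orbits are absent: it yields, in every
  neighbourhood of the origin, periodic orbits with different periods.
\<close>

definition isochronous :: "(complex \<Rightarrow> complex) \<Rightarrow> bool" where
  "isochronous X \<longleftrightarrow>
     (\<exists>U T. open U \<and> 0 \<in> U \<and>
        (\<forall>\<gamma> S. periodic_solution X \<gamma> S \<and> range \<gamma> \<subseteq> U \<longrightarrow> S = T))"

abbreviation nonisochronous :: "(complex \<Rightarrow> complex) \<Rightarrow> bool" where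
  "nonisochronous X \<equiv> \<not> isochronous X"

end

theory Submission
  imports Defs "HOL-Library.Landau_Symbols" "HOL-Library.Periodic_Fun"
    "HOL-Computational_Algebra.Polynomial"
begin

text \<open>
  The degrees that occur in the field are spread out so that \<open>j\<close> and \<open>2 j - 1\<close> never occur
  together: the number \<open>2 j - 1\<close> always lies in the gap behind the block that contains \<open>j\<close>. This
  prevents a cancellation in the expansion of the period of the orbits around the origin.

  In polar coordinates \<open>x = r e\<^sup>i\<^sup>\<theta>\<close> the Hamiltonian, normalized to vanish at the origin, is
  \<open>r\<^sup>2/2 + (\<Sum>n\<in>D. r\<^sup>n\<^sup>+\<^sup>2 f\<^sub>n(\<theta>))\<close>, where \<open>n + 1\<close> runs through the degrees of the nonlinear terms of the
  field (\<open>polar_field_if_real_hamiltonian\<close>). The angle moves with speed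
  \<open>\<theta>' = 1 + (\<Sum>n\<in>D. (n + 2) r\<^sup>n f\<^sub>n(\<theta>))\<close>. For small \<open>s > 0\<close> the level set of energy \<open>s\<^sup>2/2\<close> is a
  closed curve \<open>r = r(s, \<theta>)\<close>, and running along it with this speed is a periodic solution whose
  least period \<open>T(s)\<close> is the integral of \<open>1/\<theta>'\<close> over one turn (\<open>periodic_solution_radius\<close>).

  Let \<open>N\<close> be the least index with \<open>f\<^sub>N \<noteq> 0\<close>. The level equation gives
  \<open>r = s (1 - s\<^sup>N f\<^sub>N(\<theta>) + O(s\<^sup>N\<^sup>+\<^sup>1))\<close>, and expanding \<open>1/\<theta>'\<close> up to the order \<open>2 N\<close> gives
  (\<open>period_expansion\<close>) that the coefficient of \<open>s\<^sup>2\<^sup>N\<close> in \<open>T(s)\<close> is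
  \<open>(2 N + 2) ((N + 2) \<integral>f\<^sub>N\<^sup>2 - \<integral>f\<^bsub>2N\<^esub>)\<close>. The index \<open>2 N\<close> belongs to the degree
  \<open>2 (N + 1) - 1\<close>, which does not occur, so the second integral is absent and the coefficient is
  positive. Hence \<open>T\<close> is not constant near \<open>0\<close> (\<open>nonisochronous_if_gap\<close>).
\<close>

section \<open>Asymptotic expansion of the inverse angular speed\<close>

text \<open>
  The exponent has the form into which \<open>algebra_simps\<close> brings \<open>2 * n\<close>.
\<close>

lemma power_double: "x ^ (n * 2) = x ^ n * x ^ n" for x :: "'a::monoid_mult"
  by (simp add: power_mult power2_eq_square)

text \<open>
  The expansion has to be uniform in the angle. It is therefore carried out along an arbitrary
  filter \<open>F\<close>, with a small quantity \<open>s\<close>; errors are measured by powers of \<open>s\<close>. Below, \<open>F\<close> is a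
  filter on pairs \<open>(s, \<theta>)\<close> that lets \<open>s\<close> tend to \<open>0\<close> from the right while \<open>\<theta>\<close> ranges over one turn.
\<close>

context
  fixes F :: "'a filter" and s :: "'a \<Rightarrow> real"
  assumes s_lim: "(s \<longlongrightarrow> 0) F"
begin

lemma bigo_power_antimono:
  assumes "f \<in> O[F](\<lambda>x. s x ^ k)" "m \<le> k"
  shows "f \<in> O[F](\<lambda>x. s x ^ m)"
proof -
  have "\<forall>\<^sub>F x in F. \<bar>s x\<bar> < 1"
    using tendstoD[OF s_lim, of 1] by (simp add: dist_real_def)
  then have "\<forall>\<^sub>F x in F. norm (s x ^ k) \<le> 1 * norm (s x ^ m)"
    by eventually_elim (use assms(2) in \<open>auto simp: power_abs intro!: power_decreasing\<close>)
  then have "(\<lambda>x. s x ^ k) \<in> O[F](\<lambda>x. s x ^ m)"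
    by (rule bigoI)
  with assms(1) show ?thesis
    by (rule landau_o.big_trans)
qed

lemma bigo_power_mult:
  assumes "f \<in> O[F](\<lambda>x. s x ^ a)" "g \<in> O[F](\<lambda>x. s x ^ b)" "m \<le> a + b"
  shows "(\<lambda>x. f x * g x) \<in> O[F](\<lambda>x. s x ^ m)"
proof -
  have "(\<lambda>x. f x * g x) \<in> O[F](\<lambda>x. s x ^ (a + b))"
    using landau_o.big_mult[OF assms(1,2)] by (simp add: power_add)
  then show ?thesis
    using assms(3) by (rule bigo_power_antimono)
qed

lemmas bigo_power_mult_add = bigo_power_mult[OF _ _ order_refl]

text \<open>
  Here \<open>\<rho> = r/s\<close> is the scaled radius of the level curve and \<open>level\<close> is the equation
  \<open>H = s\<^sup>2/2\<close> divided by \<open>s\<^sup>2/2\<close>. The angular speed is \<open>1 + Q\<close>. Because of the scaling, all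
  factors other than powers of \<open>s\<close> are bounded, so that the order of an error can be read off from
  the powers of \<open>s\<close>.
\<close>

context
  fixes \<rho> :: "'a \<Rightarrow> real" and f :: "nat \<Rightarrow> 'a \<Rightarrow> real" and D :: "nat set" and N :: nat
  assumes fin: "finite D" and N: "N \<in> D" "N \<ge> 1" "\<And>n. n \<in> D \<Longrightarrow> N \<le> n"
    and f_bounded: "\<And>n. n \<in> D \<Longrightarrow> f n \<in> O[F](\<lambda>_. 1)"
    and rho_pos: "\<forall>\<^sub>F x in F. 0 < \<rho> x" and rho_bounded: "\<rho> \<in> O[F](\<lambda>_. 1)"
    and level: "\<forall>\<^sub>F x in F. (\<rho> x)\<^sup>2 * (1 + 2 * (\<Sum>n\<in>D. (s x * \<rho> x) ^ n * f n x)) = 1"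
begin

private abbreviation "P x \<equiv> \<Sum>n\<in>D. (s x * \<rho> x) ^ n * f n x"
private abbreviation "Q x \<equiv> \<Sum>n\<in>D. (n + 2) * (s x * \<rho> x) ^ n * f n x"

lemma rho_power_bounded: "(\<lambda>x. \<rho> x ^ k) \<in> O[F](\<lambda>x. s x ^ 0)"
  using landau_o.big_power[OF rho_bounded, of k] by simp

lemma f_bigo: "n \<in> D \<Longrightarrow> f n \<in> O[F](\<lambda>x. s x ^ 0)"
  using f_bounded by simp

lemma P_bigo: "P \<in> O[F](\<lambda>x. s x ^ N)"
proof (rule big_sum_in_bigo)
  fix n assume n: "n \<in> D"
  show "(\<lambda>x. (s x * \<rho> x) ^ n * f n x) \<in> O[F](\<lambda>x. s x ^ N)"
    unfolding power_mult_distrib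
    by (rule bigo_power_mult[OF bigo_power_mult_add[OF landau_o.big_refl rho_power_bounded] f_bigo[OF n]])
       (use N(3)[OF n] in auto)
qed

text \<open>
  The level equation reads \<open>(\<rho> - 1) (\<rho> + 1) = - 2 P \<rho>\<^sup>2\<close>, and \<open>\<rho> + 1\<close> is bounded below by \<open>1\<close>, so the
  error of \<open>\<rho> = 1\<close> inherits the order of \<open>P\<close>.
\<close>

lemma rho_minus_1_bigo: "(\<lambda>x. \<rho> x - 1) \<in> O[F](\<lambda>x. s x ^ N)"
proof -
  have "\<forall>\<^sub>F x in F. norm (\<rho> x - 1) \<le> 1 * norm (2 * P x * \<rho> x ^ 2)"
    using rho_pos level
  proof eventually_elim
    case (elim x)
    have "2 * P x * \<rho> x ^ 2 = - ((\<rho> x - 1) * (\<rho> x + 1))"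
      using elim(2) by (simp add: algebra_simps power2_eq_square)
    then have "norm (2 * P x * \<rho> x ^ 2) = \<bar>\<rho> x - 1\<bar> * \<bar>\<rho> x + 1\<bar>"
      by (simp only: real_norm_def abs_minus_cancel abs_mult)
    moreover have "\<bar>\<rho> x - 1\<bar> * 1 \<le> \<bar>\<rho> x - 1\<bar> * \<bar>\<rho> x + 1\<bar>"
      using elim(1) by (intro mult_left_mono) auto
    ultimately show ?case by simp
  qed
  then have "(\<lambda>x. \<rho> x - 1) \<in> O[F](\<lambda>x. 2 * P x * \<rho> x ^ 2)"
    by (rule bigoI)
  also have "(\<lambda>x. (2 * P x) * \<rho> x ^ 2) \<in> O[F](\<lambda>x. s x ^ N)"
    by (rule bigo_power_mult[OF _ rho_power_bounded]) (use P_bigo in auto)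
  finally show ?thesis .
qed

lemma rho_power_minus_1_bigo: "(\<lambda>x. \<rho> x ^ k - 1) \<in> O[F](\<lambda>x. s x ^ N)"
proof (induction k)
  case (Suc k)
  have eq: "\<rho> x ^ Suc k - 1 = \<rho> x ^ k * (\<rho> x - 1) + (\<rho> x ^ k - 1)" for x
    by (simp add: algebra_simps)
  show ?case
    unfolding eq
    by (intro sum_in_bigo Suc.IH bigo_power_mult[OF rho_power_bounded rho_minus_1_bigo]) simp
qed simp

text \<open>
  With the weights \<open>1\<close> and \<open>n + 2\<close> this gives the leading terms of \<open>P\<close> and of \<open>Q\<close>: indices above
  \<open>N\<close> contribute to higher order only, and in the term of index \<open>N\<close> the factor \<open>\<rho>\<^sup>N\<close> is close
  to \<open>1\<close>.
\<close>

lemma weighted_sum_expansion: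
  "(\<lambda>x. (\<Sum>n\<in>D. w n * (s x * \<rho> x) ^ n * f n x) - w N * s x ^ N * f N x) \<in> O[F](\<lambda>x. s x ^ (N + 1))"
proof -
  have eq: "(\<Sum>n\<in>D. w n * (s x * \<rho> x) ^ n * f n x) - w N * s x ^ N * f N x =
     w N * f N x * (s x ^ N * (\<rho> x ^ N - 1)) + (\<Sum>n\<in>D - {N}. w n * f n x * (s x ^ n * \<rho> x ^ n))" for x
    unfolding sum.remove[OF fin N(1)] by (simp add: algebra_simps power_mult_distrib)
  have wf: "(\<lambda>x. w n * f n x) \<in> O[F](\<lambda>x. s x ^ 0)" if "n \<in> D" for n
    using f_bigo[OF that] by simp
  show ?thesis
    unfolding eq
  proof (intro sum_in_bigo(1) big_sum_in_bigo)
    show "(\<lambda>x. w N * f N x * (s x ^ N * (\<rho> x ^ N - 1))) \<in> O[F](\<lambda>x. s x ^ (N + 1))"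
      by (rule bigo_power_mult[OF wf[OF N(1)] bigo_power_mult_add[OF landau_o.big_refl rho_power_minus_1_bigo]])
         (use N(2) in auto)
    fix n assume n: "n \<in> D - {N}"
    have "n \<ge> N + 1" using N(3)[of n] n by force
    then show "(\<lambda>x. w n * f n x * (s x ^ n * \<rho> x ^ n)) \<in> O[F](\<lambda>x. s x ^ (N + 1))"
      using n by (intro bigo_power_mult[OF wf bigo_power_mult_add[OF landau_o.big_refl rho_power_bounded]]) auto
  qed
qed

lemma rho_expansion: "(\<lambda>x. \<rho> x - 1 + s x ^ N * f N x) \<in> O[F](\<lambda>x. s x ^ (N + 1))"
proof -
  have 1: "(\<lambda>x. P x - s x ^ N * f N x) \<in> O[F](\<lambda>x. s x ^ (N + 1))"
    using weighted_sum_expansion[of "\<lambda>_. 1"] by simp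
  have 2: "(\<lambda>x. (\<rho> x - 1) * (\<rho> x - 1) / 2) \<in> O[F](\<lambda>x. s x ^ (N + 1))"
    using bigo_power_mult[OF rho_minus_1_bigo rho_minus_1_bigo, of "N + 1"] N(2) by simp
  have 3: "(\<lambda>x. P x * (\<rho> x ^ 2 - 1)) \<in> O[F](\<lambda>x. s x ^ (N + 1))"
    using N(2) by (intro bigo_power_mult[OF P_bigo rho_power_minus_1_bigo]) auto
  have "\<forall>\<^sub>F x in F. \<rho> x - 1 + s x ^ N * f N x =
     - (P x - s x ^ N * f N x) - (\<rho> x - 1) * (\<rho> x - 1) / 2 - P x * (\<rho> x ^ 2 - 1)"
    using level
  proof eventually_elim
    case (elim x)
    then have "P x * \<rho> x ^ 2 = (1 - \<rho> x ^ 2) / 2" by (simp add: algebra_simps)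
    then show ?case by (simp add: field_simps power2_eq_square)
  qed
  moreover have "(\<lambda>x. - (P x - s x ^ N * f N x) - (\<rho> x - 1) * (\<rho> x - 1) / 2 - P x * (\<rho> x ^ 2 - 1))
     \<in> O[F](\<lambda>x. s x ^ (N + 1))"
    by (intro sum_in_bigo(2) 2 3) (use 1 in \<open>simp only: landau_o.big.uminus_in_iff\<close>)
  ultimately show ?thesis
    by (simp only: landau_o.big.in_cong)
qed

lemma rho_power_expansion:
  "(\<lambda>x. \<rho> x ^ k - 1 + k * (s x ^ N * f N x)) \<in> O[F](\<lambda>x. s x ^ (N + 1))"
proof (induction k)
  case (Suc k)
  let ?y = "\<lambda>x. s x ^ N * f N x"
  have eq: "\<rho> x ^ Suc k - 1 + Suc k * ?y x =
    (\<rho> x ^ k - 1 + k * ?y x) + (\<rho> x ^ k - 1) * (\<rho> x - 1) + (\<rho> x - 1 + ?y x)" for x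
    by (simp add: algebra_simps)
  show ?case
    unfolding eq using N(2)
    by (intro sum_in_bigo Suc.IH rho_expansion
        bigo_power_mult[OF rho_power_minus_1_bigo rho_minus_1_bigo]) simp
qed simp

text \<open>
  Up to order \<open>2 N\<close>, replacing the radius \<open>s \<rho>\<close> by \<open>s\<close> matters only in the term of index \<open>N\<close>, where the
  correction \<open>- N s\<^sup>N f\<^sub>N\<close> of \<open>\<rho>\<^sup>N\<close> produces a square.
\<close>

lemma Q_expansion:
  "(\<lambda>x. Q x - (\<Sum>n\<in>D. (n + 2) * s x ^ n * f n x) + N * (N + 2) * s x ^ (2 * N) * (f N x)\<^sup>2)
    \<in> O[F](\<lambda>x. s x ^ (2 * N + 1))"
proof -
  have eq: "Q x - (\<Sum>n\<in>D. (n + 2) * s x ^ n * f n x) + N * (N + 2) * s x ^ (2 * N) * (f N x)\<^sup>2 =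
     (real N + 2) * f N x * (s x ^ N * (\<rho> x ^ N - 1 + N * (s x ^ N * f N x))) +
     (\<Sum>n\<in>D - {N}. (real n + 2) * f n x * (s x ^ n * (\<rho> x ^ n - 1)))" for x
  proof -
    have "Q x - (\<Sum>n\<in>D. (n + 2) * s x ^ n * f n x) =
      (\<Sum>n\<in>D. (real n + 2) * f n x * (s x ^ n * (\<rho> x ^ n - 1)))"
      unfolding sum_subtractf[symmetric]
      by (intro sum.cong refl) (simp add: power_mult_distrib right_diff_distrib mult_ac add_ac)
    also have "\<dots> = (real N + 2) * f N x * (s x ^ N * (\<rho> x ^ N - 1)) +
      (\<Sum>n\<in>D - {N}. (real n + 2) * f n x * (s x ^ n * (\<rho> x ^ n - 1)))"
      by (rule sum.remove[OF fin N(1)])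
    also have "(real N + 2) * f N x * (s x ^ N * (\<rho> x ^ N - 1)) =
      (real N + 2) * f N x * (s x ^ N * (\<rho> x ^ N - 1 + N * (s x ^ N * f N x)))
      - N * (N + 2) * s x ^ (2 * N) * (f N x)\<^sup>2"
      by (simp add: algebra_simps power2_eq_square power_double)
    finally show ?thesis by simp
  qed
  have wf: "(\<lambda>x. (real n + 2) * f n x) \<in> O[F](\<lambda>x. s x ^ 0)" if "n \<in> D" for n
    using f_bigo[OF that] by simp
  show ?thesis
    unfolding eq
  proof (intro sum_in_bigo(1) big_sum_in_bigo)
    show "(\<lambda>x. (real N + 2) * f N x * (s x ^ N * (\<rho> x ^ N - 1 + N * (s x ^ N * f N x))))
      \<in> O[F](\<lambda>x. s x ^ (2 * N + 1))"
      by (rule bigo_power_mult[OF wf[OF N(1)] bigo_power_mult_add[OF landau_o.big_refl rho_power_expansion]]) auto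
    fix n assume n: "n \<in> D - {N}"
    have "n \<ge> N + 1" using N(3)[of n] n by force
    then show "(\<lambda>x. (real n + 2) * f n x * (s x ^ n * (\<rho> x ^ n - 1))) \<in> O[F](\<lambda>x. s x ^ (2 * N + 1))"
      using n by (intro bigo_power_mult[OF wf bigo_power_mult_add[OF landau_o.big_refl rho_power_minus_1_bigo]]) auto
  qed
qed

text \<open>
  The geometric series for \<open>1/(1 + Q)\<close> can be cut after \<open>Q\<^sup>2\<close>, as \<open>Q\<^sup>3\<close> has order \<open>3 N > 2 N\<close>. The
  squares coming from \<open>- Q\<close> and from \<open>Q\<^sup>2\<close> have the same sign and add up to
  \<open>N (N + 2) + (N + 2)\<^sup>2 = (2 N + 2) (N + 2)\<close>; this is why the second order effect cannot cancel.
\<close>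

lemma inverse_speed_expansion:
  "(\<lambda>x. 1 / (1 + Q x) - 1 + (\<Sum>n\<in>D. (n + 2) * s x ^ n * f n x)
      - (2 * N + 2) * (N + 2) * s x ^ (2 * N) * (f N x)\<^sup>2)
    \<in> O[F](\<lambda>x. s x ^ (2 * N + 1))"
proof -
  let ?y = "\<lambda>x. (real N + 2) * s x ^ N * f N x"
  have Qy: "(\<lambda>x. Q x - ?y x) \<in> O[F](\<lambda>x. s x ^ (N + 1))"
    using weighted_sum_expansion[of "\<lambda>n. real n + 2"] by (simp add: add_ac)
  have y: "?y \<in> O[F](\<lambda>x. s x ^ N)"
    by (rule bigo_power_mult[OF _ f_bigo[OF N(1)], of _ N]) auto
  have Q: "Q \<in> O[F](\<lambda>x. s x ^ N)"
    using sum_in_bigo(1)[OF bigo_power_antimono[OF Qy, of N] y] by simp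
  have "(\<lambda>x. s x ^ N) \<in> o[F](\<lambda>_. 1)"
    using tendsto_power[OF s_lim, of N] N(2) by (intro smalloI_tendsto) (auto simp: power_0_left)
  from landau_o.big_small_trans[OF Q this] have "(Q \<longlongrightarrow> 0) F"
    by (auto dest: smalloD_tendsto)
  from tendstoD[OF this, of "1/2"] have small: "\<forall>\<^sub>F x in F. \<bar>Q x\<bar> < 1 / 2"
    by (simp add: dist_real_def)
  have "\<forall>\<^sub>F x in F. norm (1 / (1 + Q x)) \<le> 2 * norm (s x ^ 0)"
    using small by eventually_elim (auto simp: field_simps)
  then have inv: "(\<lambda>x. 1 / (1 + Q x)) \<in> O[F](\<lambda>x. s x ^ 0)"
    by (rule bigoI)
  have 1: "(\<lambda>x. (Q x - ?y x) * (Q x + ?y x)) \<in> O[F](\<lambda>x. s x ^ (2 * N + 1))"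
    by (rule bigo_power_mult[OF Qy sum_in_bigo(1)[OF Q y]]) auto
  have 2: "(\<lambda>x. Q x * Q x * Q x * (1 / (1 + Q x))) \<in> O[F](\<lambda>x. s x ^ (2 * N + 1))"
    using N(2) by (intro bigo_power_mult[OF bigo_power_mult_add[OF bigo_power_mult_add[OF Q Q] Q] inv]) auto
  \<comment> \<open>To be used with \<open>a\<close> and \<open>c\<close> as in \<open>Q_expansion\<close> and \<open>y\<close> the leading term of \<open>Q\<close>.\<close>
  have geometric: "1 / (1 + q) - 1 + a - b = (q - y) * (q + y) - q * q * q * (1 / (1 + q)) - (q - a + c)"
    if "1 + q \<noteq> 0" "b = c + y * y" for q y a b c :: real
  proof -
    have "1 / (1 + q) = 1 - q + q * q - q * q * q * (1 / (1 + q))"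
      using that(1) by (simp add: field_simps)
    moreover have "(q - y) * (q + y) = q * q - y * y"
      by (simp add: algebra_simps)
    ultimately show ?thesis
      using that(2) by linarith
  qed
  have "\<forall>\<^sub>F x in F. 1 / (1 + Q x) - 1 + (\<Sum>n\<in>D. (n + 2) * s x ^ n * f n x)
      - (2 * N + 2) * (N + 2) * s x ^ (2 * N) * (f N x)\<^sup>2 =
      (Q x - ?y x) * (Q x + ?y x) - Q x * Q x * Q x * (1 / (1 + Q x)) -
      (Q x - (\<Sum>n\<in>D. (n + 2) * s x ^ n * f n x) + N * (N + 2) * s x ^ (2 * N) * (f N x)\<^sup>2)"
    using small
  proof eventually_elim
    case (elim x)
    show ?case
    proof (rule geometric)
      show "1 + Q x \<noteq> 0" using elim by auto
      show "real ((2 * N + 2) * (N + 2)) * s x ^ (2 * N) * (f N x)\<^sup>2 =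
        real (N * (N + 2)) * s x ^ (2 * N) * (f N x)\<^sup>2 + ?y x * ?y x"
        by (simp add: algebra_simps power2_eq_square power_double)
    qed
  qed
  moreover have "(\<lambda>x. (Q x - ?y x) * (Q x + ?y x) - Q x * Q x * Q x * (1 / (1 + Q x)) -
      (Q x - (\<Sum>n\<in>D. (n + 2) * s x ^ n * f n x) + N * (N + 2) * s x ^ (2 * N) * (f N x)\<^sup>2))
     \<in> O[F](\<lambda>x. s x ^ (2 * N + 1))"
    by (intro sum_in_bigo(2) 1 2 Q_expansion)
  ultimately show ?thesis
    by (simp only: landau_o.big.in_cong)
qed

end

end

text \<open>
  A polynomial of order \<open>s\<^sup>M\<close> tends to \<open>0\<close>, so its constant coefficient vanishes; dividing by \<open>s\<close>
  gives the other coefficients by induction.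
\<close>

lemma poly_bigo_imp_coeff_eq_0:
  fixes p :: "real poly"
  assumes "poly p \<in> O[at_right 0](\<lambda>s. s ^ M)" "i < M"
  shows "coeff p i = 0"
  using assms
proof (induction M arbitrary: p i)
  case (Suc M)
  obtain a q where p: "p = pCons a q" by (cases p)
  have "((\<lambda>s. s ^ Suc M) \<longlongrightarrow> 0 ^ Suc M) (at_right (0::real))"
    by (intro tendsto_intros)
  then have "(\<lambda>s. s ^ Suc M) \<in> o[at_right (0::real)](\<lambda>_. 1)"
    by (intro smalloI_tendsto) auto
  from landau_o.big_small_trans[OF Suc.prems(1) this] have "(poly p \<longlongrightarrow> 0) (at_right 0)"
    by (auto dest: smalloD_tendsto)
  moreover have "(poly p \<longlongrightarrow> poly p 0) (at_right 0)"
    by (intro tendsto_intros)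
  ultimately have "poly p 0 = 0"
    by (intro tendsto_unique[of "at_right (0::real)"]) auto
  then have a: "a = 0" by (simp add: p)
  have nz: "\<forall>\<^sub>F s in at_right (0::real). s \<noteq> 0"
    by (simp add: eventually_at_filter)
  have "(\<lambda>s. poly q s * s) \<in> O[at_right 0](\<lambda>s. s ^ M * s)"
    using Suc.prems(1) by (simp add: p a mult_ac)
  then have "(\<lambda>s. poly q s * s / s) \<in> O[at_right 0](\<lambda>s. s ^ M * s / s)"
    by (rule landau_o.big.divide_right[OF nz])
  moreover have "\<forall>\<^sub>F s in at_right 0. poly q s * s / s = poly q s"
    by (rule eventually_mono[OF nz]) simp
  moreover have "\<forall>\<^sub>F s in at_right (0::real). s ^ M * s / s = s ^ M"
    by (rule eventually_mono[OF nz]) simp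
  ultimately have "poly q \<in> O[at_right 0](\<lambda>s. s ^ M)"
    by (simp only: landau_o.big.cong_ex)
  then have IH: "j < M \<Longrightarrow> coeff q j = 0" for j
    by (rule Suc.IH)
  show ?case
  proof (cases i)
    case 0
    then show ?thesis by (simp only: p a coeff_pCons_0)
  next
    case (Suc j)
    then show ?thesis using IH[of j] Suc.prems(2) by (simp only: p coeff_pCons_Suc)
  qed
qed (simp only: not_less_zero)

section \<open>Solutions along closed curves\<close>

lemma cis_eq_cis_obtain:
  assumes "cis a = cis b"
  obtains n :: int where "a = b + 2 * pi * of_int n"
proof -
  have "sin a = sin b \<and> cos a = cos b"
    using assms by (simp add: complex_eq_iff)
  then obtain n :: int where "a = b + 2 * pi * of_int n"
    using sin_cos_eq_iff by blast
  then show ?thesis by (rule that)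
qed

text \<open>
  Solving the differential equation reduces to a quadrature: if the field is tangent to a closed
  curve given in polar coordinates and moves the angle with speed \<open>G > 0\<close>, then the time needed to reach
  the angle \<open>\<theta>\<close> is an antiderivative \<open>\<tau>\<close> of \<open>1/G\<close>, and its inverse function parametrizes a
  solution. The period is least because during a shorter time the angle advances by less than a
  full turn.
\<close>

lemma periodic_solution_along_curve:
  fixes X :: "complex \<Rightarrow> complex" and R R' G :: "real \<Rightarrow> real"
  assumes G_cont: "continuous_on UNIV G" and G_pos: "\<And>\<theta>. G \<theta> > 0"
    and G_per: "\<And>\<theta>. G (\<theta> + 2 * pi) = G \<theta>"
    and R_pos: "\<And>\<theta>. R \<theta> > 0" and R_per: "\<And>\<theta>. R (\<theta> + 2 * pi) = R \<theta>"
    and R_deriv: "\<And>\<theta>. (R has_real_derivative R' \<theta>) (at \<theta>)"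
    and field: "\<And>\<theta>. X (R \<theta> * cis \<theta>) = cis \<theta> * Complex (R' \<theta> * G \<theta>) (R \<theta> * G \<theta>)"
  obtains \<gamma> where "periodic_solution X \<gamma> (integral {0..2*pi} (\<lambda>\<theta>. 1 / G \<theta>))"
    "\<And>t. \<exists>\<theta>. \<gamma> t = R \<theta> * cis \<theta>"
proof -
  define T where "T = integral {0..2*pi} (\<lambda>\<theta>. 1 / G \<theta>)"
  have G_isCont: "isCont G x" for x
    using G_cont by (simp add: continuous_on_eq_continuous_at)
  have "isCont (\<lambda>\<theta>. 1 / G \<theta>) x" for x
    using G_isCont G_pos[of x] by (intro continuous_intros) auto
  then obtain \<tau> where \<tau>': "\<And>x. (\<tau> has_vector_derivative (1 / G x)) (at x)"
    using einterval_antiderivative[of "-\<infinity>" "\<infinity>" "\<lambda>\<theta>. 1 / G \<theta>"] by auto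
  then have \<tau>: "(\<tau> has_real_derivative (1 / G x)) (at x)" for x
    by (simp add: has_real_derivative_iff_has_vector_derivative)
  have \<tau>_cont: "isCont \<tau> x" for x
    using \<tau> by (rule DERIV_isCont)
  have \<tau>_less: "\<tau> a < \<tau> b" if "a < b" for a b
    using \<tau> G_pos by (intro DERIV_pos_imp_increasing[OF that]) (metis zero_less_divide_1_iff)
  have T: "T = \<tau> (2 * pi) - \<tau> 0"
    unfolding T_def using \<tau>'
    by (intro integral_unique fundamental_theorem_of_calculus)
       (auto intro: has_vector_derivative_at_within)
  have T_pos: "T > 0"
    using T \<tau>_less[of 0 "2 * pi"] by simp
  have \<tau>_shift: "\<tau> (x + 2 * pi) = \<tau> x + T" for x
  proof -
    have "((\<lambda>x. \<tau> (x + 2 * pi) - \<tau> x) has_real_derivative 0) (at y)" for y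
      using \<tau>[of "y + 2 * pi"] \<tau>[of y] G_per[of y]
      by (auto intro!: derivative_eq_intros simp: DERIV_shift)
    from DERIV_isconst_all[of "\<lambda>x. \<tau> (x + 2 * pi) - \<tau> x" x 0] this
    show ?thesis by (simp add: T)
  qed
  have \<tau>_shift_n: "\<tau> (x + 2 * pi * n) = \<tau> x + n * T" for x and n :: nat
  proof (induction n)
    case (Suc n)
    have "\<tau> (x + 2 * pi * Suc n) = \<tau> (x + 2 * pi * n + 2 * pi)"
      by (simp add: algebra_simps)
    also have "\<dots> = \<tau> x + Suc n * T"
      unfolding \<tau>_shift Suc.IH by (simp add: algebra_simps)
    finally show ?case .
  qed simp
  \<comment> \<open>Each turn adds the positive time \<open>T\<close>, so \<open>\<tau>\<close> is unbounded in both directions.\<close>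
  have \<tau>_surj: "\<exists>x. \<tau> x = y" for y
  proof -
    obtain n :: nat where n: "\<bar>y - \<tau> 0\<bar> < n * T"
      using reals_Archimedean3[OF T_pos] by auto
    have "\<tau> (2 * pi * n) = \<tau> 0 + n * T" "\<tau> 0 = \<tau> (- 2 * pi * n) + n * T"
      using \<tau>_shift_n[of 0 n] \<tau>_shift_n[of "- 2 * pi * n" n] by simp_all
    then have "\<tau> (- 2 * pi * n) \<le> y" "y \<le> \<tau> (2 * pi * n)"
      using n by linarith+
    from IVT[of \<tau>, OF this] show ?thesis using \<tau>_cont by auto
  qed
  define \<phi> where "\<phi> y = (SOME x. \<tau> x = y)" for y
  have \<tau>\<phi>: "\<tau> (\<phi> y) = y" for y
    unfolding \<phi>_def by (rule someI_ex[OF \<tau>_surj])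
  have \<tau>_inj: "\<tau> a = \<tau> b \<Longrightarrow> a = b" for a b
    using \<tau>_less[of a b] \<tau>_less[of b a] by (cases a b rule: linorder_cases) auto
  have \<phi>\<tau>: "\<phi> (\<tau> x) = x" for x
    by (rule \<tau>_inj) (simp add: \<tau>\<phi>)
  have \<phi>_cont: "isCont \<phi> y" for y
    using isCont_inverse_function[of 1 "\<phi> y" \<phi> \<tau>] \<phi>\<tau> \<tau>_cont by (simp add: \<tau>\<phi>)
  have \<phi>: "(\<phi> has_real_derivative G (\<phi> y)) (at y)" for y
    using DERIV_inverse_function[OF \<tau>, of \<phi> y "y - 1" "y + 1"] \<tau>\<phi> \<phi>_cont G_pos[of "\<phi> y"]
    by simp
  have \<phi>_shift: "\<phi> (y + T) = \<phi> y + 2 * pi" for y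
    by (rule \<tau>_inj) (simp add: \<tau>\<phi> \<tau>_shift)
  have \<phi>_less: "\<phi> a < \<phi> b" if "a < b" for a b
    using \<tau>_less[of "\<phi> b" "\<phi> a"] that \<tau>\<phi> by (metis linorder_neqE_linordered_idom order_less_asym)
  define \<gamma> where "\<gamma> t = R (\<phi> t) * cis (\<phi> t)" for t
  have norm_\<gamma>: "norm (\<gamma> t) = R (\<phi> t)" for t
    using R_pos[of "\<phi> t"] by (simp add: \<gamma>_def norm_mult)
  have "(\<gamma> has_vector_derivative X (\<gamma> t)) (at t)" for t
  proof -
    have R\<phi>: "((\<lambda>t. R (\<phi> t)) has_real_derivative R' (\<phi> t) * G (\<phi> t)) (at t)"
      by (rule DERIV_chain2[OF R_deriv \<phi>])
    have "((\<lambda>t. cis (\<phi> t)) has_vector_derivative G (\<phi> t) *\<^sub>R (\<i> * cis (\<phi> t))) (at t)"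
      using \<phi>[of t] unfolding has_field_derivative_def has_vector_derivative_def
      by (auto intro!: derivative_eq_intros simp: fun_eq_iff scaleR_conv_of_real)
    from has_vector_derivative_mult[OF has_vector_derivative_of_real[OF R\<phi>] this]
    show ?thesis
      unfolding \<gamma>_def field
      by (simp add: scaleR_conv_of_real Complex_eq algebra_simps)
  qed
  moreover have "\<gamma> (t + T) = \<gamma> t" for t
    by (simp add: \<gamma>_def \<phi>_shift R_per flip: cis_mult)
  moreover have "\<exists>t. \<gamma> (t + u) \<noteq> \<gamma> t" if u: "0 < u" "u < T" for u
  proof (rule ccontr)
    assume "\<not> (\<exists>t. \<gamma> (t + u) \<noteq> \<gamma> t)"
    then have eq: "\<gamma> (0 + u) = \<gamma> 0" by blast
    then have "R (\<phi> (0 + u)) = R (\<phi> 0)" by (metis norm_\<gamma>)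
    with eq have "cis (\<phi> (0 + u)) = cis (\<phi> 0)"
      using R_pos[of "\<phi> 0"] by (simp add: \<gamma>_def)
    then obtain n :: int where n: "\<phi> (0 + u) = \<phi> 0 + 2 * pi * of_int n"
      by (rule cis_eq_cis_obtain)
    have "\<phi> 0 < \<phi> (0 + u)" "\<phi> (0 + u) < \<phi> 0 + 2 * pi"
      using \<phi>_less[of 0 "0 + u"] \<phi>_less[of "0 + u" "0 + T"] u by (auto simp flip: \<phi>_shift)
    then have "0 < (of_int n :: real)" "(of_int n :: real) < 1"
      unfolding n by (auto simp: zero_less_mult_iff)
    then have "0 < n" "n < 1" by simp_all
    then show False by linarith
  qed
  ultimately have "periodic_solution X \<gamma> T"
    using T_pos by (simp add: periodic_solution_def solution_def)
  then show ?thesis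
    by (intro that[of \<gamma>]) (auto simp: T_def \<gamma>_def)
qed

section \<open>Hamiltonian fields in polar coordinates and their period function\<close>

text \<open>
  A field with the Hamiltonian \<open>r\<^sup>2/2 + (\<Sum>n\<in>D. r\<^sup>n\<^sup>+\<^sup>2 f n \<theta>)\<close> in polar coordinates: the first component
  of the \<open>Complex\<close> is \<open>r'\<close> and the second one is \<open>r \<theta>'\<close>. The index \<open>n\<close> is one less than the
  degree of the corresponding part of the field, so that it is the order of its effect on the angular
  speed.
\<close>

locale polar_field =
  fixes X :: "complex \<Rightarrow> complex" and D :: "nat set" and f f' :: "nat \<Rightarrow> real \<Rightarrow> real"
  assumes finite_D: "finite D" and D_pos: "\<And>n. n \<in> D \<Longrightarrow> 1 \<le> n"
    and f_deriv: "\<And>n \<theta>. n \<in> D \<Longrightarrow> (f n has_real_derivative f' n \<theta>) (at \<theta>)"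
    and f_per: "\<And>n \<theta>. n \<in> D \<Longrightarrow> f n (\<theta> + 2 * pi) = f n \<theta>"
    and field: "\<And>r \<theta>. r > 0 \<Longrightarrow> X (r * cis \<theta>) =
      cis \<theta> * Complex (- (\<Sum>n\<in>D. r ^ (n + 1) * f' n \<theta>)) (r + (\<Sum>n\<in>D. real (n + 2) * r ^ (n + 1) * f n \<theta>))"
begin

definition energy :: "real \<Rightarrow> real \<Rightarrow> real" where
  "energy r \<theta> = r\<^sup>2 / 2 + (\<Sum>n\<in>D. r ^ (n + 2) * f n \<theta>)"

definition angular_speed :: "real \<Rightarrow> real \<Rightarrow> real" where
  "angular_speed r \<theta> = 1 + (\<Sum>n\<in>D. real (n + 2) * r ^ n * f n \<theta>)"

lemma f_isCont: "n \<in> D \<Longrightarrow> isCont (f n) \<theta>"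
  using f_deriv by (rule DERIV_isCont)

lemma f_continuous_on: "n \<in> D \<Longrightarrow> continuous_on A (f n)"
  using f_isCont by (simp add: continuous_at_imp_continuous_on)

text \<open>
  One \<open>t\<close> serves all indices, since all \<open>f n\<close> have the same period.
\<close>

lemma f_per_reduce: "\<exists>t\<in>{0..2*pi}. \<forall>n\<in>D. f n \<theta> = f n t"
proof -
  define t where "t = \<theta> - of_int \<lfloor>\<theta> / (2 * pi)\<rfloor> * (2 * pi)"
  have "f n t = f n \<theta>" if "n \<in> D" for n
  proof -
    interpret periodic_fun_simple "f n" "2 * pi"
      by unfold_locales (simp add: f_per that)
    show ?thesis unfolding t_def by (rule minus_of_int)
  qed
  moreover have "t = frac (\<theta> / (2 * pi)) * (2 * pi)"
    by (simp add: t_def frac_def left_diff_distrib)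
  then have "t \<in> {0..2*pi}"
    using frac_ge_0[of "\<theta> / (2 * pi)"] frac_lt_1[of "\<theta> / (2 * pi)"]
    by (simp add: mult_le_cancel_right1)
  ultimately show ?thesis by (intro bexI[of _ t]) auto
qed

lemma f_bounded_obtain:
  obtains M where "M \<ge> 0" "\<And>n \<theta>. n \<in> D \<Longrightarrow> \<bar>f n \<theta>\<bar> \<le> M"
proof -
  define g where "g \<theta> = (\<Sum>n\<in>D. \<bar>f n \<theta>\<bar>)" for \<theta>
  have "compact (g ` {0..2*pi})"
    unfolding g_def by (intro compact_continuous_image continuous_intros f_continuous_on) auto
  then obtain M where M: "\<And>\<theta>. \<theta> \<in> {0..2*pi} \<Longrightarrow> \<bar>g \<theta>\<bar> \<le> M"
    using compact_imp_bounded bounded_iff by (metis imageI real_norm_def)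
  have "\<bar>f n \<theta>\<bar> \<le> M" if n: "n \<in> D" for n \<theta>
  proof -
    obtain t where t: "t \<in> {0..2*pi}" "f n \<theta> = f n t"
      using f_per_reduce n by blast
    have "\<bar>f n t\<bar> \<le> g t"
      unfolding g_def by (rule member_le_sum) (use n finite_D in auto)
    with t M[OF t(1)] show ?thesis by simp
  qed
  moreover have "M \<ge> 0" using M[of 0] by force
  ultimately show ?thesis by (rule that[rotated])
qed

text \<open>
  Up to the radius \<open>\<delta>\<close> the nonlinear terms change the angular speed by at most one half, uniformly in the
  angle. The absolute values inside the sum make the same bound available for the energy, whose terms
  have smaller weights.
\<close>

lemma small_radius_obtain:
  obtains \<delta> where "\<delta> > 0"
    "\<And>r \<theta>. 0 \<le> r \<Longrightarrow> r \<le> \<delta> \<Longrightarrow> (\<Sum>n\<in>D. real (n + 2) * r ^ n * \<bar>f n \<theta>\<bar>) \<le> 1 / 2"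
proof -
  obtain M where M: "M \<ge> 0" "\<And>n \<theta>. n \<in> D \<Longrightarrow> \<bar>f n \<theta>\<bar> \<le> M"
    using f_bounded_obtain by blast
  define K where "K = 1 + (\<Sum>n\<in>D. real (n + 2) * M)"
  have K: "K \<ge> 1" unfolding K_def using M(1) by (simp add: sum_nonneg)
  show ?thesis
  proof (rule that[of "1 / (2 * K)"])
    show "1 / (2 * K) > 0" using K by simp
    fix r \<theta> :: real assume r: "0 \<le> r" "r \<le> 1 / (2 * K)"
    have "1 / (2 * K) \<le> 1" using K by simp
    with r have r1: "r \<le> 1" by linarith
    have "(\<Sum>n\<in>D. real (n + 2) * r ^ n * \<bar>f n \<theta>\<bar>) \<le> (\<Sum>n\<in>D. real (n + 2) * r * M)"
    proof (intro sum_mono mult_mono)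
      fix n assume "n \<in> D"
      then show "r ^ n \<le> r"
        using D_pos r r1 power_decreasing[of 1 n r] by simp
    qed (use r M in auto)
    also have "\<dots> = r * (K - 1)"
      by (simp add: K_def sum_distrib_left mult_ac)
    also have "\<dots> \<le> r * K"
      using r by (simp add: mult_left_mono)
    also have "\<dots> \<le> 1 / 2"
      using r K by (simp add: field_simps)
    finally show "(\<Sum>n\<in>D. real (n + 2) * r ^ n * \<bar>f n \<theta>\<bar>) \<le> 1 / 2" .
  qed
qed

lemma energy_factor: "energy r \<theta> = r\<^sup>2 / 2 * (1 + 2 * (\<Sum>n\<in>D. r ^ n * f n \<theta>))"
  by (simp add: energy_def algebra_simps sum_distrib_left power2_eq_square)

lemma radius_times_angular_speed:
  "r * angular_speed r \<theta> = r + (\<Sum>n\<in>D. real (n + 2) * r ^ (n + 1) * f n \<theta>)"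
  by (simp add: angular_speed_def algebra_simps sum_distrib_left)

lemma energy_deriv_radius:
  "((\<lambda>r. energy r \<theta>) has_real_derivative r * angular_speed r \<theta>) (at r)"
proof -
  have "((\<lambda>r. r ^ (n + 2) * f n \<theta>) has_real_derivative real (n + 2) * r ^ (n + 1) * f n \<theta>) (at r)" for n
    using DERIV_cmult_right[OF DERIV_pow[of "n + 2" r], of "f n \<theta>"] by simp
  moreover have "((\<lambda>r. r\<^sup>2 / 2) has_real_derivative r) (at r)"
    by (auto intro!: derivative_eq_intros)
  ultimately have "((\<lambda>r. energy r \<theta>) has_real_derivative
      r + (\<Sum>n\<in>D. real (n + 2) * r ^ (n + 1) * f n \<theta>)) (at r)"
    unfolding energy_def by (intro DERIV_add DERIV_sum)
  then show ?thesis
    by (simp only: radius_times_angular_speed)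
qed

lemma energy_deriv_angle:
  "(energy r has_real_derivative (\<Sum>n\<in>D. r ^ (n + 2) * f' n \<theta>)) (at \<theta>)"
  unfolding energy_def
  by (auto intro!: derivative_eq_intros f_deriv simp: mult_ac)

lemma energy_per: "energy r (\<theta> + 2 * pi) = energy r \<theta>"
  by (simp add: energy_def f_per)

lemma angular_speed_per: "angular_speed r (\<theta> + 2 * pi) = angular_speed r \<theta>"
  by (simp add: angular_speed_def f_per)

context
  fixes \<delta> :: real
  assumes \<delta>_pos: "\<delta> > 0"
    and small: "\<And>r \<theta>. 0 \<le> r \<Longrightarrow> r \<le> \<delta> \<Longrightarrow> (\<Sum>n\<in>D. real (n + 2) * r ^ n * \<bar>f n \<theta>\<bar>) \<le> 1 / 2"
begin

lemma angular_speed_lower: "0 \<le> r \<Longrightarrow> r \<le> \<delta> \<Longrightarrow> 1 / 2 \<le> angular_speed r \<theta>"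
proof -
  assume r: "0 \<le> r" "r \<le> \<delta>"
  have "\<bar>\<Sum>n\<in>D. (n + 2) * r ^ n * f n \<theta>\<bar> \<le> (\<Sum>n\<in>D. \<bar>(n + 2) * r ^ n * f n \<theta>\<bar>)"
    by (rule sum_abs)
  also have "\<dots> \<le> 1 / 2"
    using small[OF r] r by (simp add: abs_mult)
  finally show ?thesis by (simp add: angular_speed_def)
qed

lemma energy_bounds:
  assumes r: "0 \<le> r" "r \<le> \<delta>"
  shows "r\<^sup>2 / 4 \<le> energy r \<theta>" "energy r \<theta> \<le> 3 / 4 * r\<^sup>2"
proof -
  have "\<bar>\<Sum>n\<in>D. r ^ n * f n \<theta>\<bar> \<le> (\<Sum>n\<in>D. \<bar>r ^ n * f n \<theta>\<bar>)"
    by (rule sum_abs)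
  also have "\<dots> \<le> (\<Sum>n\<in>D. real (n + 2) * r ^ n * \<bar>f n \<theta>\<bar> / 2)"
    using r by (intro sum_mono) (simp add: abs_mult mult_right_mono field_simps)
  also have "\<dots> = (\<Sum>n\<in>D. real (n + 2) * r ^ n * \<bar>f n \<theta>\<bar>) / 2"
    by (simp only: sum_divide_distrib)
  also have "\<dots> \<le> 1 / 4"
    using small[OF r, of \<theta>] by linarith
  finally have P: "\<bar>\<Sum>n\<in>D. r ^ n * f n \<theta>\<bar> \<le> 1 / 4" .
  have "r\<^sup>2 / 2 * (1 / 2) \<le> energy r \<theta>"
    unfolding energy_factor using P by (intro mult_left_mono) auto
  moreover have "energy r \<theta> \<le> r\<^sup>2 / 2 * (3 / 2)"
    unfolding energy_factor using P by (intro mult_left_mono) auto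
  ultimately show "r\<^sup>2 / 4 \<le> energy r \<theta>" "energy r \<theta> \<le> 3 / 4 * r\<^sup>2"
    by auto
qed

text \<open>
  The radial derivative of the energy is \<open>r\<close> times the angular speed, hence at least \<open>c/2\<close> for radii
  between \<open>c\<close> and \<open>\<delta>\<close>. This quantitative monotonicity makes the radius of a level curve unique and
  continuous in the angle.
\<close>

lemma energy_expanding:
  assumes "0 \<le> c" "c \<le> a" "a \<le> b" "b \<le> \<delta>"
  shows "c / 2 * (b - a) \<le> energy b \<theta> - energy a \<theta>"
proof -
  have "energy a \<theta> - c / 2 * a \<le> energy b \<theta> - c / 2 * b"
  proof (rule DERIV_nonneg_imp_nondecreasing[OF assms(3)])
    fix r assume r: "a \<le> r" "r \<le> b"
    have "c * (1 / 2) \<le> r * angular_speed r \<theta>"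
      using assms r by (intro mult_mono angular_speed_lower) auto
    moreover have "((\<lambda>r. energy r \<theta> - c / 2 * r) has_real_derivative
       r * angular_speed r \<theta> - c / 2) (at r)"
      by (auto intro!: derivative_eq_intros energy_deriv_radius)
    ultimately show "\<exists>y. ((\<lambda>r. energy r \<theta> - c / 2 * r) has_real_derivative y) (at r) \<and> 0 \<le> y"
      by (intro exI[of _ "r * angular_speed r \<theta> - c / 2"]) auto
  qed
  then show ?thesis unfolding right_diff_distrib by linarith
qed

lemma energy_expanding_abs:
  assumes "0 \<le> c" "c \<le> a" "c \<le> b" "a \<le> \<delta>" "b \<le> \<delta>"
  shows "c / 2 * \<bar>b - a\<bar> \<le> \<bar>energy b \<theta> - energy a \<theta>\<bar>"
  using energy_expanding[of c a b \<theta>] energy_expanding[of c b a \<theta>] assms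
  by (cases "a \<le> b") (auto simp: abs_if)

text \<open>
  The level curve of energy \<open>s\<^sup>2/2\<close>, which would be the circle of radius \<open>s\<close> for the linear field.
\<close>

definition radius :: "real \<Rightarrow> real \<Rightarrow> real" where
  "radius s \<theta> = (SOME r. 0 < r \<and> r < \<delta> \<and> energy r \<theta> = s\<^sup>2 / 2)"

lemma radius_per: "radius s (\<theta> + 2 * pi) = radius s \<theta>"
  by (simp add: radius_def energy_per)

context
  fixes s :: real
  assumes s: "0 < s" "s < \<delta> / 2"
begin

lemma radius: "0 < radius s \<theta>" "radius s \<theta> < \<delta>" "energy (radius s \<theta>) \<theta> = s\<^sup>2 / 2"
proof -
  have "s\<^sup>2 \<le> \<delta>\<^sup>2 / 4"
    using s power_mono[of s "\<delta> / 2" 2] by (simp add: power_divide)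
  moreover have "0 < s\<^sup>2"
    using s by simp
  ultimately have s2: "s\<^sup>2 / 2 < \<delta>\<^sup>2 / 4"
    by linarith
  have "energy 0 \<theta> = 0" by (simp add: energy_def)
  moreover have "s\<^sup>2 / 2 < energy \<delta> \<theta>"
    using energy_bounds(1)[of \<delta> \<theta>] \<delta>_pos s2 by simp
  moreover have "isCont (\<lambda>r. energy r \<theta>) r" for r
    using energy_deriv_radius by (rule DERIV_isCont)
  ultimately obtain r where r: "0 \<le> r" "r \<le> \<delta>" "energy r \<theta> = s\<^sup>2 / 2"
    using IVT[of "\<lambda>r. energy r \<theta>" 0 "s\<^sup>2 / 2" \<delta>] \<delta>_pos by auto
  moreover have "r \<noteq> 0" "r \<noteq> \<delta>"
    using r(3) \<open>energy 0 \<theta> = 0\<close> \<open>s\<^sup>2 / 2 < energy \<delta> \<theta>\<close> s by auto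
  ultimately have "\<exists>r. 0 < r \<and> r < \<delta> \<and> energy r \<theta> = s\<^sup>2 / 2"
    by (intro exI[of _ r]) auto
  from someI_ex[OF this] show "0 < radius s \<theta>" "radius s \<theta> < \<delta>" "energy (radius s \<theta>) \<theta> = s\<^sup>2 / 2"
    by (simp_all add: radius_def)
qed

lemma radius_bounds: "s / 2 \<le> radius s \<theta>" "radius s \<theta> \<le> 2 * s"
proof -
  let ?r = "radius s \<theta>"
  have "s\<^sup>2 / 2 \<le> 3 / 4 * ?r\<^sup>2" "?r\<^sup>2 / 4 \<le> s\<^sup>2 / 2"
    using energy_bounds[of ?r \<theta>] radius[of \<theta>] by auto
  then have "s\<^sup>2 \<le> (2 * ?r)\<^sup>2" "?r\<^sup>2 \<le> (2 * s)\<^sup>2"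
    using zero_le_power2[of s] zero_le_power2[of ?r] by (auto simp: power_mult_distrib)
  then have "s \<le> 2 * ?r" "?r \<le> 2 * s"
    using power2_le_imp_le[of s "2 * ?r"] power2_le_imp_le[of ?r "2 * s"] radius[of \<theta>] s by auto
  then show "s / 2 \<le> ?r" "?r \<le> 2 * s" by auto
qed

lemma radius_isCont: "isCont (radius s) \<theta>"
proof -
  let ?r = "radius s \<theta>"
  have bound: "norm (radius s z - ?r) \<le> 4 / s * \<bar>energy ?r z - energy ?r \<theta>\<bar>" for z
  proof -
    have "s / 2 / 2 * \<bar>radius s z - ?r\<bar> \<le> \<bar>energy (radius s z) z - energy ?r z\<bar>"
      using radius[of z] radius[of \<theta>] radius_bounds[of z] radius_bounds[of \<theta>] s
      by (intro energy_expanding_abs) auto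
    also have "\<dots> = \<bar>energy ?r z - energy ?r \<theta>\<bar>"
      by (simp add: radius abs_minus_commute)
    finally show ?thesis using s by (simp add: field_simps)
  qed
  have "((\<lambda>z. 4 / s * \<bar>energy ?r z - energy ?r \<theta>\<bar>) \<longlongrightarrow> 4 / s * \<bar>energy ?r \<theta> - energy ?r \<theta>\<bar>) (at \<theta>)"
    using DERIV_isCont[OF energy_deriv_angle] by (intro tendsto_intros) (simp add: isCont_def)
  then have lim: "((\<lambda>z. 4 / s * \<bar>energy ?r z - energy ?r \<theta>\<bar>) \<longlongrightarrow> 0) (at \<theta>)"
    by simp
  have "((\<lambda>z. radius s z - ?r) \<longlongrightarrow> 0) (at \<theta>)"
    by (rule Lim_null_comparison[OF always_eventually[OF allI[OF bound]] lim])
  then show ?thesis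
    by (simp add: isCont_def LIM_zero_iff)
qed

text \<open>
  Implicit differentiation of the level equation. The energy is a polynomial in the radius, so
  its increment is the product of the increment of the radius and a divided difference \<open>\<Delta>\<close>
  that is explicit and visibly continuous; solving for the increment of the radius gives its
  derivative in the sense of Caratheodory.
\<close>

lemma radius_deriv:
  "(radius s has_real_derivative
     - (\<Sum>n\<in>D. radius s \<theta> ^ (n + 1) * f' n \<theta>) / angular_speed (radius s \<theta>) \<theta>) (at \<theta>)"
proof -
  define r0 where "r0 = radius s \<theta>"
  have r0: "0 < r0" "r0 < \<delta>" unfolding r0_def by (rule radius)+
  \<comment> \<open>The sum over \<open>i\<close> is \<open>(r\<^sup>n\<^sup>+\<^sup>2 - r0\<^sup>n\<^sup>+\<^sup>2)/(r - r0)\<close>, written without division.\<close>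
  define \<Delta> where "\<Delta> r z = (r + r0) / 2 + (\<Sum>n\<in>D. (\<Sum>i<n + 2. r ^ i * r0 ^ (n + 1 - i)) * f n z)" for r z
  have \<Delta>: "energy r z - energy r0 z = (r - r0) * \<Delta> r z" for r z
  proof -
    have pow: "r ^ (n + 2) - r0 ^ (n + 2) = (r - r0) * (\<Sum>i<n + 2. r ^ i * r0 ^ (n + 1 - i))" for n
      using diff_power_eq_sum[of r "n + 1" r0] by simp
    have "r ^ (n + 2) * f n z - r0 ^ (n + 2) * f n z =
        (r - r0) * ((\<Sum>i<n + 2. r ^ i * r0 ^ (n + 1 - i)) * f n z)" for n
      unfolding pow left_diff_distrib[symmetric] by (simp only: mult.assoc)
    then have "(\<Sum>n\<in>D. r ^ (n + 2) * f n z) - (\<Sum>n\<in>D. r0 ^ (n + 2) * f n z) =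
        (r - r0) * (\<Sum>n\<in>D. (\<Sum>i<n + 2. r ^ i * r0 ^ (n + 1 - i)) * f n z)"
      by (simp only: sum_distrib_left flip: sum_subtractf)
    moreover have "r\<^sup>2 / 2 - r0\<^sup>2 / 2 = (r - r0) * ((r + r0) / 2)"
      by (simp add: power2_eq_square field_simps)
    ultimately show ?thesis
      unfolding energy_def \<Delta>_def distrib_left[of "r - r0"] by linarith
  qed
  have \<Delta>_diag: "\<Delta> r0 z = r0 * angular_speed r0 z" for z
  proof -
    have "(\<Sum>i<n + 2. r0 ^ i * r0 ^ (n + 1 - i)) = (n + 2) * r0 ^ (n + 1)" for n :: nat
    proof -
      have "(\<Sum>i<n + 2. r0 ^ i * r0 ^ (n + 1 - i)) = (\<Sum>i<n + 2. r0 ^ (n + 1))"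
        by (intro sum.cong) (simp_all flip: power_add)
      then show ?thesis by simp
    qed
    then show ?thesis
      by (simp add: \<Delta>_def angular_speed_def algebra_simps sum_distrib_left)
  qed
  have \<Delta>_pos: "\<Delta> (radius s z) z \<noteq> 0" for z
  proof (cases "radius s z = r0")
    case True
    then show ?thesis
      using \<Delta>_diag[of z] r0 angular_speed_lower[of r0 z] by auto
  next
    case False
    have "0 < s / 2 / 2 * \<bar>radius s z - r0\<bar>" using False s by simp
    also have "\<dots> \<le> \<bar>energy (radius s z) z - energy r0 z\<bar>"
      using radius[of z] r0 radius_bounds[of z] radius_bounds[of \<theta>] s
      by (intro energy_expanding_abs) (auto simp: r0_def)
    finally show ?thesis using \<Delta> by auto
  qed
  obtain g where g: "\<And>z. energy r0 z - energy r0 \<theta> = g z * (z - \<theta>)" "isCont g \<theta>"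
    "g \<theta> = (\<Sum>n\<in>D. r0 ^ (n + 2) * f' n \<theta>)"
    using energy_deriv_angle[of r0 \<theta>] unfolding CARAT_DERIV by blast
  have diff_eq: "radius s z - radius s \<theta> = - g z / \<Delta> (radius s z) z * (z - \<theta>)" for z
  proof -
    have "(radius s z - r0) * \<Delta> (radius s z) z = - (g z * (z - \<theta>))"
      using \<Delta>[of "radius s z" z] g(1)[of z] radius(3)[of z] radius(3)[of \<theta>] by (simp add: r0_def)
    then show ?thesis using \<Delta>_pos[of z] by (simp add: r0_def field_simps)
  qed
  have cont: "isCont (\<lambda>z. - g z / \<Delta> (radius s z) z) \<theta>"
    using \<Delta>_pos g(2) unfolding \<Delta>_def
    by (intro continuous_intros radius_isCont f_isCont) auto
  have val: "- g \<theta> / \<Delta> (radius s \<theta>) \<theta> =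
      - (\<Sum>n\<in>D. radius s \<theta> ^ (n + 1) * f' n \<theta>) / angular_speed (radius s \<theta>) \<theta>"
  proof -
    have "g \<theta> = r0 * (\<Sum>n\<in>D. r0 ^ (n + 1) * f' n \<theta>)"
      by (simp add: g(3) sum_distrib_left mult_ac)
    then show ?thesis
      using r0 \<Delta>_diag[of \<theta>] unfolding r0_def by simp
  qed
  show ?thesis
    unfolding CARAT_DERIV
    by (intro exI[of _ "\<lambda>z. - g z / \<Delta> (radius s z) z"] conjI allI diff_eq cont val)
qed

lemma angular_speed_radius_continuous:
  "continuous_on A (\<lambda>\<theta>. angular_speed (radius s \<theta>) \<theta>)"
  unfolding angular_speed_def
  by (intro continuous_intros f_continuous_on continuous_at_imp_continuous_on ballI radius_isCont)

lemma periodic_solution_radius: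
  obtains \<gamma> where "periodic_solution X \<gamma> (integral {0..2*pi} (\<lambda>\<theta>. 1 / angular_speed (radius s \<theta>) \<theta>))"
    "\<And>t. norm (\<gamma> t) \<le> 2 * s"
proof -
  have speed_pos: "angular_speed (radius s \<theta>) \<theta> > 0" for \<theta>
    using angular_speed_lower[of "radius s \<theta>" \<theta>] radius[of \<theta>] by simp
  obtain \<gamma> where \<gamma>: "periodic_solution X \<gamma> (integral {0..2*pi} (\<lambda>\<theta>. 1 / angular_speed (radius s \<theta>) \<theta>))"
    "\<And>t. \<exists>\<theta>. \<gamma> t = radius s \<theta> * cis \<theta>"
  proof (rule periodic_solution_along_curve[of "\<lambda>\<theta>. angular_speed (radius s \<theta>) \<theta>" "radius s", 
        OF angular_speed_radius_continuous speed_pos _ radius(1) radius_per radius_deriv])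
    show "angular_speed (radius s (\<theta> + 2 * pi)) (\<theta> + 2 * pi) = angular_speed (radius s \<theta>) \<theta>" for \<theta>
      by (simp add: radius_per angular_speed_per)
    show "X (radius s \<theta> * cis \<theta>) = cis \<theta> * Complex
       (- (\<Sum>n\<in>D. radius s \<theta> ^ (n + 1) * f' n \<theta>) / angular_speed (radius s \<theta>) \<theta> * angular_speed (radius s \<theta>) \<theta>)
       (radius s \<theta> * angular_speed (radius s \<theta>) \<theta>)" for \<theta>
      using speed_pos[of \<theta>] unfolding field[OF radius(1)] radius_times_angular_speed by simp
  qed blast
  have "norm (\<gamma> t) \<le> 2 * s" for t
  proof -
    obtain \<theta> where "\<gamma> t = radius s \<theta> * cis \<theta>" using \<gamma>(2) by blast
    then show ?thesis
      using radius(1)[of \<theta>] radius_bounds(2)[of \<theta>] by (simp add: norm_mult)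
  qed
  with \<gamma>(1) show ?thesis by (rule that)
qed

end

text \<open>
  The expansion of the inverse angular speed is uniform in the angle and can be integrated term by
  term. The sum keeps all indices of \<open>D\<close>, also those of order above \<open>2 N\<close>; this makes the main part
  a polynomial in \<open>s\<close> without any truncation.
\<close>

lemma period_expansion:
  assumes N: "N \<in> D" "\<And>n. n \<in> D \<Longrightarrow> N \<le> n"
  shows "(\<lambda>s. integral {0..2*pi} (\<lambda>\<theta>. 1 / angular_speed (radius s \<theta>) \<theta>) - 2 * pi
      + (\<Sum>n\<in>D. real (n + 2) * s ^ n * integral {0..2*pi} (f n))
      - real ((2 * N + 2) * (N + 2)) * s ^ (2 * N) * integral {0..2*pi} (\<lambda>\<theta>. (f N \<theta>)\<^sup>2))
    \<in> O[at_right 0](\<lambda>s. s ^ (2 * N + 1))"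
proof -
  define E where "E s \<theta> = 1 / angular_speed (radius s \<theta>) \<theta> - 1
      + (\<Sum>n\<in>D. real (n + 2) * s ^ n * f n \<theta>)
      - real ((2 * N + 2) * (N + 2)) * s ^ (2 * N) * (f N \<theta>)\<^sup>2" for s \<theta>
  define F where "F = at_right (0::real) \<times>\<^sub>F principal {0..2*pi}"
  define \<rho> where "\<rho> x = radius (fst x) (snd x) / fst x" for x
  have "\<forall>\<^sub>F s in at_right 0. 0 < s \<and> s < \<delta> / 2"
    unfolding eventually_at_right_field using \<delta>_pos by (intro exI[of _ "\<delta> / 2"]) auto
  moreover have fst_lim: "filterlim fst (at_right 0) F"
    unfolding F_def by (rule filterlim_fst)
  ultimately have ev: "\<forall>\<^sub>F x in F. 0 < fst x \<and> fst x < \<delta> / 2"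
    unfolding filterlim_iff by blast
  have rho_bounds: "\<forall>\<^sub>F x in F. 0 < \<rho> x \<and> \<rho> x \<le> 2"
    using ev by eventually_elim (simp add: \<rho>_def radius radius_bounds divide_le_eq)
  have level: "\<forall>\<^sub>F x in F. (\<rho> x)\<^sup>2 * (1 + 2 * (\<Sum>n\<in>D. (fst x * \<rho> x) ^ n * f n (snd x))) = 1"
    using ev
  proof eventually_elim
    case (elim x)
    then have r: "fst x * \<rho> x = radius (fst x) (snd x)" by (simp add: \<rho>_def)
    have "(fst x * \<rho> x)\<^sup>2 / 2 * (1 + 2 * (\<Sum>n\<in>D. (fst x * \<rho> x) ^ n * f n (snd x))) = (fst x)\<^sup>2 / 2"
      using radius(3)[of "fst x" "snd x"] elim unfolding r energy_factor by simp
    moreover have "b\<^sup>2 * y = 1" if "(a * b)\<^sup>2 / 2 * y = a\<^sup>2 / 2" "0 < a" for a b y :: real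
      using that by (simp add: power_mult_distrib)
    ultimately show ?case
      using elim by blast
  qed
  obtain M where M: "M \<ge> 0" "\<And>n \<theta>. n \<in> D \<Longrightarrow> \<bar>f n \<theta>\<bar> \<le> M"
    using f_bounded_obtain by blast
  have "(\<lambda>x. 1 / (1 + (\<Sum>n\<in>D. real (n + 2) * (fst x * \<rho> x) ^ n * f n (snd x))) - 1
      + (\<Sum>n\<in>D. real (n + 2) * fst x ^ n * f n (snd x))
      - real ((2 * N + 2) * (N + 2)) * fst x ^ (2 * N) * (f N (snd x))\<^sup>2)
    \<in> O[F](\<lambda>x. fst x ^ (2 * N + 1))"
  proof (rule inverse_speed_expansion[where f = "\<lambda>n x. f n (snd x)"])
    show "(fst \<longlongrightarrow> 0) F"
      using fst_lim by (rule filterlim_mono) (auto simp: at_within_le_nhds)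
    show "(\<lambda>x. f n (snd x)) \<in> O[F](\<lambda>_. 1)" if "n \<in> D" for n
      using M(2)[OF that] by (intro bigoI[of _ M] always_eventually) simp
    show "\<rho> \<in> O[F](\<lambda>_. 1)"
      using rho_bounds by (intro bigoI[of _ 2]) (auto elim!: eventually_mono)
    show "\<forall>\<^sub>F x in F. 0 < \<rho> x"
      using rho_bounds by (auto elim!: eventually_mono)
  qed (use N level finite_D D_pos in auto)
  then obtain c where c: "c > 0" "\<forall>\<^sub>F x in F.
      norm (1 / (1 + (\<Sum>n\<in>D. real (n + 2) * (fst x * \<rho> x) ^ n * f n (snd x))) - 1
      + (\<Sum>n\<in>D. real (n + 2) * fst x ^ n * f n (snd x))
      - real ((2 * N + 2) * (N + 2)) * fst x ^ (2 * N) * (f N (snd x))\<^sup>2)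
      \<le> c * norm (fst x ^ (2 * N + 1))"
    by (rule landau_o.bigE)
  from c(2) ev have "\<forall>\<^sub>F x in F. norm (E (fst x) (snd x)) \<le> c * norm (fst x ^ (2 * N + 1))"
    by eventually_elim (simp add: E_def angular_speed_def \<rho>_def)
  then have "\<forall>\<^sub>F s in at_right 0. \<forall>\<theta>\<in>{0..2*pi}. norm (E s \<theta>) \<le> c * norm (s ^ (2 * N + 1))"
    unfolding F_def eventually_prod_filter eventually_principal by (auto elim!: eventually_mono)
  moreover have "\<forall>\<^sub>F s in at_right 0. 0 < s \<and> s < \<delta> / 2"
    by fact
  ultimately have "\<forall>\<^sub>F s in at_right 0. norm (integral {0..2*pi} (\<lambda>\<theta>. 1 / angular_speed (radius s \<theta>) \<theta>) - 2 * pi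
      + (\<Sum>n\<in>D. real (n + 2) * s ^ n * integral {0..2*pi} (f n))
      - real ((2 * N + 2) * (N + 2)) * s ^ (2 * N) * integral {0..2*pi} (\<lambda>\<theta>. (f N \<theta>)\<^sup>2))
      \<le> (c * (2 * pi)) * norm (s ^ (2 * N + 1))"
  proof eventually_elim
    case (elim s)
    have cont: "continuous_on {0..2*pi} (\<lambda>\<theta>. 1 / angular_speed (radius s \<theta>) \<theta>)"
    proof (intro continuous_intros angular_speed_radius_continuous ballI)
      show "angular_speed (radius s \<theta>) \<theta> \<noteq> 0" for \<theta>
        using angular_speed_lower[of "radius s \<theta>" \<theta>] radius[of s \<theta>] elim by auto
    qed (use elim in auto)
    have "(E s has_integral integral {0..2*pi} (\<lambda>\<theta>. 1 / angular_speed (radius s \<theta>) \<theta>) - 2 * pi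
      + (\<Sum>n\<in>D. real (n + 2) * s ^ n * integral {0..2*pi} (f n))
      - real ((2 * N + 2) * (N + 2)) * s ^ (2 * N) * integral {0..2*pi} (\<lambda>\<theta>. (f N \<theta>)\<^sup>2)) {0..2*pi}"
      unfolding E_def
    proof (intro has_integral_diff has_integral_add has_integral_sum has_integral_mult_right
        integrable_integral integrable_continuous_real cont finite_D f_continuous_on)
      show "((\<lambda>\<theta>. 1::real) has_integral 2 * pi) {0..2*pi}"
        using has_integral_const_real[of "1::real" 0 "2 * pi"] by simp
    qed (use N in \<open>auto intro!: continuous_intros f_continuous_on\<close>)
    moreover have "continuous_on {0..2*pi} (E s)"
      unfolding E_def using N(1) by (intro continuous_intros cont f_continuous_on)
    then have "norm (integral {0..2*pi} (E s)) \<le> (c * norm (s ^ (2 * N + 1))) * (2 * pi - 0)"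
      using elim by (intro integral_bound) auto
    ultimately show ?case
      by (simp add: integral_unique mult_ac)
  qed
  then show ?thesis by (rule bigoI)
qed

end

text \<open>
  If all periods near the origin were equal to \<open>T\<close>, then the main part of \<open>period_expansion\<close> would be a
  polynomial in \<open>s\<close> of order \<open>s\<^sup>2\<^sup>N\<^sup>+\<^sup>1\<close>. Its coefficient of \<open>s\<^sup>2\<^sup>N\<close> is a nonzero multiple of the
  integral of \<open>f\<^sub>N\<^sup>2\<close> because no term linear in the \<open>f\<^sub>n\<close> has the index \<open>2 N\<close>.
\<close>

theorem nonisochronous_if_gap:
  assumes N: "N \<in> D" "\<And>n. n \<in> D \<Longrightarrow> N \<le> n" and gap: "2 * N \<notin> D"
    and nonzero: "f N \<theta>\<^sub>0 \<noteq> 0"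
  shows "nonisochronous X"
proof
  assume "isochronous X"
  then obtain U T where U: "open U" "0 \<in> U"
    and T: "\<And>\<gamma> S. periodic_solution X \<gamma> S \<Longrightarrow> range \<gamma> \<subseteq> U \<Longrightarrow> S = T"
    unfolding isochronous_def by blast
  obtain e where e: "e > 0" "ball 0 e \<subseteq> U"
    using U open_contains_ball by blast
  obtain \<delta> where \<delta>: "\<delta> > 0"
    "\<And>r \<theta>. 0 \<le> r \<Longrightarrow> r \<le> \<delta> \<Longrightarrow> (\<Sum>n\<in>D. real (n + 2) * r ^ n * \<bar>f n \<theta>\<bar>) \<le> 1 / 2"
    using small_radius_obtain by blast
  let ?T = "\<lambda>s. integral {0..2*pi} (\<lambda>\<theta>. 1 / angular_speed (radius \<delta> s \<theta>) \<theta>)"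
  have "?T s = T" if s: "0 < s" "s < min (\<delta> / 2) (e / 2)" for s
  proof -
    obtain \<gamma> where \<gamma>: "periodic_solution X \<gamma> (?T s)" "\<And>t. norm (\<gamma> t) \<le> 2 * s"
      using periodic_solution_radius[OF \<delta>, of s] s by auto
    have "\<gamma> t \<in> ball 0 e" for t
      using \<gamma>(2)[of t] s by simp
    then show ?thesis
      using e by (intro T[OF \<gamma>(1)]) auto
  qed
  then have "\<forall>\<^sub>F s in at_right 0. ?T s = T"
    unfolding eventually_at_right_field using \<delta>(1) e(1)
    by (intro exI[of _ "min (\<delta> / 2) (e / 2)"]) auto
  define I where "I = integral {0..2*pi} (\<lambda>\<theta>. (f N \<theta>)\<^sup>2)"
  define p where "p = [:T - 2 * pi:] + (\<Sum>n\<in>D. monom (real (n + 2) * integral {0..2*pi} (f n)) n)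
      - monom (real ((2 * N + 2) * (N + 2)) * I) (2 * N)"
  have "\<forall>\<^sub>F s in at_right 0. poly p s = ?T s - 2 * pi
      + (\<Sum>n\<in>D. real (n + 2) * s ^ n * integral {0..2*pi} (f n))
      - real ((2 * N + 2) * (N + 2)) * s ^ (2 * N) * I"
    using \<open>\<forall>\<^sub>F s in at_right 0. ?T s = T\<close>
    by eventually_elim (simp add: p_def poly_sum poly_monom mult_ac)
  then have "poly p \<in> O[at_right 0](\<lambda>s. s ^ (2 * N + 1))"
    using period_expansion[OF \<delta> N] unfolding I_def by (simp only: landau_o.big.in_cong)
  then have "coeff p (2 * N) = 0"
    by (rule poly_bigo_imp_coeff_eq_0) simp
  moreover have "coeff p (2 * N) = - (real ((2 * N + 2) * (N + 2)) * I)"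
  proof -
    have "(\<Sum>n\<in>D. coeff (monom (real (n + 2) * integral {0..2*pi} (f n)) n) (2 * N)) = 0"
      using gap by (intro sum.neutral) auto
    moreover have "coeff [:T - 2 * pi:] (2 * N) = 0"
      using D_pos[OF N(1)] by (simp add: coeff_pCons split: nat.split)
    ultimately show ?thesis
      by (simp add: p_def coeff_sum del: of_nat_mult of_nat_add)
  qed
  moreover have "real ((2 * N + 2) * (N + 2)) \<noteq> 0"
    unfolding of_nat_eq_0_iff by simp
  ultimately have "I = 0" by (simp only: neg_equal_0_iff_equal mult_eq_0_iff) blast
  then have "\<forall>\<theta>\<in>{0..2*pi}. (f N \<theta>)\<^sup>2 = 0"
    using N(1) unfolding I_def
    by (subst (asm) integral_eq_0_iff) (auto intro!: continuous_intros f_continuous_on)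
  then show False
    using f_per_reduce[of \<theta>\<^sub>0] N(1) nonzero by auto
qed

end

section \<open>Polar form of real Hamiltonian polynomial fields\<close>

lemma real_polynomial_function_has_derivative:
  assumes "real_polynomial_function h"
  shows "\<exists>h'. (h has_derivative h') (at x)"
  using assms
proof (induction h rule: real_polynomial_function.induct)
  case (linear h)
  then show ?case using bounded_linear_imp_has_derivative by blast
next
  case (const c)
  then show ?case using has_derivative_const by blast
next
  case (add g h)
  then show ?case using has_derivative_add by blast
next
  case (mult g h)
  then show ?case using has_derivative_mult by blast
qed

text \<open>
  The Hamiltonian in polar coordinates, where Hamilton's equations are \<open>r \<theta>' = \<partial>\<^sub>r g\<close> and
  \<open>r r' = - \<partial>\<^sub>\<theta> g\<close>. Multiplying the field by the conjugate of \<open>cis \<theta>\<close> yields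
  \<open>r' + \<i> r \<theta>'\<close>.
\<close>

lemma real_hamiltonian_polar:
  assumes "real_hamiltonian X"
  obtains g :: "real \<Rightarrow> real \<Rightarrow> real" where
    "\<And>r \<theta>. ((\<lambda>r. g r \<theta>) has_real_derivative Im (cnj (cis \<theta>) * X (r * cis \<theta>))) (at r)"
    "\<And>r \<theta>. (g r has_real_derivative - r * Re (cnj (cis \<theta>) * X (r * cis \<theta>))) (at \<theta>)"
    "\<And>\<theta>. g 0 \<theta> = 0"
proof -
  obtain H where H: "real_polynomial_function H"
    and X: "\<And>u v. X (Complex u v) =
           Complex (- deriv (\<lambda>s. H (u, s)) v) (deriv (\<lambda>s. H (s, v)) u)"
    using assms unfolding real_hamiltonian_def by blast
  obtain H' where H': "\<And>x. (H has_derivative H' x) (at x)"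
    using real_polynomial_function_has_derivative[OF H] by metis
  define Hu where "Hu x = H' x (1, 0)" for x
  define Hv where "Hv x = H' x (0, 1)" for x
  have H'_eq: "H' x (a, b) = a * Hu x + b * Hv x" for x a b
  proof -
    interpret bounded_linear "H' x" using H' by (rule has_derivative_bounded_linear)
    have "(a, b) = a *\<^sub>R (1, 0) + b *\<^sub>R (0, 1)" by simp
    then show ?thesis by (simp only: add scale Hu_def Hv_def) simp
  qed
  have chain: "((\<lambda>t. H (a t, b t)) has_real_derivative a' * Hu (a t, b t) + b' * Hv (a t, b t)) (at t)"
    if "(a has_real_derivative a') (at t)" "(b has_real_derivative b') (at t)" for a b a' b' t
  proof -
    have ab: "((\<lambda>t. (a t, b t)) has_derivative (\<lambda>h. (a' * h, b' * h))) (at t)"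
      using that by (intro has_derivative_Pair) (auto simp: has_field_derivative_def)
    have "(\<lambda>h. a' * h * Hu (a t, b t) + b' * h * Hv (a t, b t)) =
        (*) (a' * Hu (a t, b t) + b' * Hv (a t, b t))"
      by (simp add: fun_eq_iff algebra_simps)
    with has_derivative_compose[OF ab H'] show ?thesis
      unfolding has_field_derivative_def H'_eq by simp
  qed
  have X': "X (Complex u v) = Complex (- Hv (u, v)) (Hu (u, v))" for u v
  proof -
    have "deriv (\<lambda>s. H (u, s)) v = Hv (u, v)"
      using chain[OF DERIV_const DERIV_ident, of u v] by (intro DERIV_imp_deriv) simp
    moreover have "deriv (\<lambda>s. H (s, v)) u = Hu (u, v)"
      using chain[OF DERIV_ident DERIV_const, of v u] by (intro DERIV_imp_deriv) simp
    ultimately show ?thesis by (simp add: X)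
  qed
  have rcis: "complex_of_real r * cis \<theta> = Complex (r * cos \<theta>) (r * sin \<theta>)" for r \<theta>
    by (simp add: complex_eq_iff)
  define g where "g r \<theta> = H (r * cos \<theta>, r * sin \<theta>) - H (0, 0)" for r \<theta>
  show ?thesis
  proof (rule that[of g])
    show "((\<lambda>r. g r \<theta>) has_real_derivative Im (cnj (cis \<theta>) * X (r * cis \<theta>))) (at r)" for r \<theta>
    proof -
      have "((\<lambda>r. H (r * cos \<theta>, r * sin \<theta>)) has_real_derivative
        cos \<theta> * Hu (r * cos \<theta>, r * sin \<theta>) + sin \<theta> * Hv (r * cos \<theta>, r * sin \<theta>)) (at r)"
        by (rule chain) (auto intro!: derivative_eq_intros)
      then show ?thesis
        unfolding g_def rcis X' by (auto intro!: derivative_eq_intros)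
    qed
    show "(g r has_real_derivative - r * Re (cnj (cis \<theta>) * X (r * cis \<theta>))) (at \<theta>)" for r \<theta>
    proof -
      have "((\<lambda>\<theta>. H (r * cos \<theta>, r * sin \<theta>)) has_real_derivative
        (- r * sin \<theta>) * Hu (r * cos \<theta>, r * sin \<theta>) + (r * cos \<theta>) * Hv (r * cos \<theta>, r * sin \<theta>)) (at \<theta>)"
        by (rule chain) (auto intro!: derivative_eq_intros)
      then show ?thesis
        unfolding g_def rcis X' by (auto intro!: derivative_eq_intros simp: algebra_simps)
    qed
  qed (simp add: g_def)
qed

lemma hom_field_scale: "hom_field p j (of_real r * z) = of_real r ^ j * hom_field p j z"
  unfolding hom_field_def sum_distrib_left
proof (rule sum.cong)
  fix i assume "i \<in> {0..j}"
  then have "complex_of_real r ^ j = of_real r ^ (j - i) * of_real r ^ i"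
    by (simp flip: power_add)
  then show "p (int j - int i - 1) i * (of_real r * z) ^ (j - i) * cnj (of_real r * z) ^ i =
      of_real r ^ j * (p (int j - int i - 1) i * z ^ (j - i) * cnj z ^ i)"
    by (simp add: power_mult_distrib mult_ac)
qed simp

lemma hom_field_cis_differentiable:
  "(\<lambda>\<theta>. cnj (cis \<theta>) * hom_field p j (cis \<theta>)) differentiable (at \<theta>)"
proof -
  have cis: "cis differentiable (at \<theta>)" for \<theta>
    unfolding differentiable_def using has_derivative_cis[OF has_derivative_ident] by blast
  have "cnj (cis \<theta>) = cis (- \<theta>)" for \<theta>
    by (simp add: cis_cnj)
  moreover have "(\<lambda>\<theta>. cis (- \<theta>)) differentiable (at \<theta>)"
    unfolding differentiable_def
    using has_derivative_cis[OF has_derivative_minus[OF has_derivative_ident]] by blast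
  ultimately have cnj_cis: "(\<lambda>\<theta>. cnj (cis \<theta>)) differentiable (at \<theta>)" by simp
  show ?thesis
    unfolding hom_field_def
    by (intro differentiable_mult differentiable_sum differentiable_power differentiable_const
        ballI cis cnj_cis finite_atLeastAtMost)
qed

text \<open>
  Integrating the radial equation expresses the Hamiltonian by the imaginary parts of \<open>a j\<close>. Its
  derivative with respect to the angle is given by the real parts, and both are polynomials in \<open>r\<close>;
  comparing coefficients shows that the real parts are, up to sign, the derivatives of the angular
  factors of the Hamiltonian.
\<close>

lemma polar_field_if_real_hamiltonian:
  fixes p :: "int \<Rightarrow> nat \<Rightarrow> complex" and J :: "nat set"
  defines "a \<equiv> \<lambda>j \<theta>. cnj (cis \<theta>) * hom_field p j (cis \<theta>)"
  assumes fin: "finite J" and J: "\<And>j. j \<in> J \<Longrightarrow> 2 \<le> j"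
    and X: "X = (\<lambda>x. lin_field x + (\<Sum>j\<in>J. hom_field p j x))" and ham: "real_hamiltonian X"
  shows "polar_field X ((\<lambda>j. j - 1) ` J)
    (\<lambda>n \<theta>. Im (a (n + 1) \<theta>) / real (n + 2)) (\<lambda>n \<theta>. - Re (a (n + 1) \<theta>))"
proof -
  have polar: "cnj (cis \<theta>) * X (r * cis \<theta>) = \<i> * r + (\<Sum>j\<in>J. of_real (r ^ j) * a j \<theta>)" for r \<theta>
  proof -
    have "cnj (cis \<theta>) * (\<i> * (r * cis \<theta>)) = \<i> * r * (cis \<theta> * cnj (cis \<theta>))"
      by (simp add: mult_ac)
    also have "\<dots> = \<i> * r"
      by (simp add: cis_cnj cis_mult)
    finally have "cnj (cis \<theta>) * (\<i> * (r * cis \<theta>)) = \<i> * r" .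
    moreover have "(\<Sum>j\<in>J. cnj (cis \<theta>) * hom_field p j (r * cis \<theta>)) = (\<Sum>j\<in>J. of_real (r ^ j) * a j \<theta>)"
      unfolding hom_field_scale a_def by (intro sum.cong) (simp_all add: mult_ac)
    ultimately show ?thesis
      unfolding X lin_field_def by (simp only: distrib_left sum_distrib_left)
  qed
  define h where "h j \<theta> = Im (a j \<theta>) / real (j + 1)" for j \<theta>
  obtain g :: "real \<Rightarrow> real \<Rightarrow> real" where
    g_r: "\<And>r \<theta>. ((\<lambda>r. g r \<theta>) has_real_derivative Im (cnj (cis \<theta>) * X (r * cis \<theta>))) (at r)" and
    g_\<theta>: "\<And>r \<theta>. (g r has_real_derivative - r * Re (cnj (cis \<theta>) * X (r * cis \<theta>))) (at \<theta>)" and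
    g_0: "\<And>\<theta>. g 0 \<theta> = 0"
    using real_hamiltonian_polar[OF ham] by blast
  have g: "g r \<theta> = r\<^sup>2 / 2 + (\<Sum>j\<in>J. r ^ (j + 1) * h j \<theta>)" for r \<theta>
  proof -
    let ?d = "\<lambda>r. g r \<theta> - (r\<^sup>2 / 2 + (\<Sum>j\<in>J. r ^ (j + 1) * h j \<theta>))"
    have "(?d has_real_derivative 0) (at r)" for r
    proof -
      have "((\<lambda>r. r ^ (j + 1) * h j \<theta>) has_real_derivative r ^ j * Im (a j \<theta>)) (at r)" for j
        using DERIV_cmult_right[OF DERIV_pow[of "j + 1" r], of "h j \<theta>"]
        by (simp add: h_def del: power_Suc)
      moreover have "((\<lambda>r. r\<^sup>2 / 2) has_real_derivative r) (at r)"
        by (auto intro!: derivative_eq_intros)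
      ultimately have "(?d has_real_derivative
          Im (cnj (cis \<theta>) * X (r * cis \<theta>)) - (r + (\<Sum>j\<in>J. r ^ j * Im (a j \<theta>)))) (at r)"
        by (intro DERIV_diff DERIV_add DERIV_sum g_r)
      then show ?thesis unfolding polar by (simp flip: of_real_power)
    qed
    then have "?d r = ?d 0" by (intro DERIV_isconst_all) auto
    then show ?thesis by (simp add: g_0)
  qed
  have a_per: "a j (\<theta> + 2 * pi) = a j \<theta>" for j \<theta>
    by (simp add: a_def flip: cis_mult)
  have h_deriv: "(h j has_real_derivative - Re (a j \<theta>)) (at \<theta>)" if j: "j \<in> J" for j \<theta>
  proof -
    have "\<exists>d. (h j has_real_derivative d) (at \<theta>)" for j
    proof -
      obtain d where d: "(a j has_derivative d) (at \<theta>)"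
        using hom_field_cis_differentiable[of p j \<theta>] unfolding a_def differentiable_def by blast
      have "(h j has_derivative (\<lambda>t. Im (d t) / real (j + 1))) (at \<theta>)"
        unfolding h_def
        by (intro bounded_linear.has_derivative[OF bounded_linear_divide]
            bounded_linear.has_derivative[OF bounded_linear_Im] d)
      then have "h j differentiable (at \<theta>)" unfolding differentiable_def by blast
      then show ?thesis by (simp add: real_differentiable_def)
    qed
    then obtain h' where h': "\<And>j. (h j has_real_derivative h' j) (at \<theta>)" by metis
    have coeffs: "(\<Sum>j\<in>J. r ^ (j + 1) * (h' j + Re (a j \<theta>))) = 0" for r
    proof -
      have "(g r has_real_derivative 0 + (\<Sum>j\<in>J. r ^ (j + 1) * h' j)) (at \<theta>)"
        unfolding g by (intro DERIV_add DERIV_sum DERIV_cmult DERIV_const h')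
      from DERIV_unique[OF this g_\<theta>] have "(\<Sum>j\<in>J. r ^ (j + 1) * h' j) =
          - (\<Sum>j\<in>J. r ^ (j + 1) * Re (a j \<theta>))"
        unfolding polar by (simp add: sum_distrib_left sum_negf mult_ac flip: of_real_power)
      then show ?thesis by (simp add: distrib_left sum.distrib)
    qed
    define q where "q = (\<Sum>j\<in>J. monom (h' j + Re (a j \<theta>)) (j + 1))"
    have "poly q r = 0" for r
      using coeffs[of r] by (simp add: q_def poly_sum poly_monom mult.commute)
    then have "q = 0" by (simp add: poly_all_0_iff_0[symmetric])
    moreover have "coeff q (j + 1) = h' j + Re (a j \<theta>)"
      using fin j by (simp add: q_def coeff_sum)
    ultimately have "h' j = - Re (a j \<theta>)" by simp
    with h'[of j] show ?thesis by simp
  qed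
  have inj: "inj_on (\<lambda>j. j - 1) J"
    using J by (intro inj_onI) (metis One_nat_def Suc_pred le_trans less_eq_Suc_le one_le_numeral)
  have reindex: "(\<Sum>n\<in>(\<lambda>j. j - 1) ` J. w (n + 1)) = (\<Sum>j\<in>J. w j)" for w :: "nat \<Rightarrow> real"
    unfolding sum.reindex[OF inj] by (intro sum.cong) (auto dest: J)
  have D: "n + 1 \<in> J \<and> 1 \<le> n" if "n \<in> (\<lambda>j. j - 1) ` J" for n
    using that J by force
  show ?thesis
  proof
    show "finite ((\<lambda>j. j - 1) ` J)" using fin by simp
    fix n assume "n \<in> (\<lambda>j. j - 1) ` J"
    note n = D[OF this]
    show "1 \<le> n" using n by simp
    show "((\<lambda>\<theta>. Im (a (n + 1) \<theta>) / real (n + 2)) has_real_derivative - Re (a (n + 1) \<theta>)) (at \<theta>)" for \<theta>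
      using h_deriv[of "n + 1" \<theta>] n by (simp add: h_def[abs_def])
    show "Im (a (n + 1) (\<theta> + 2 * pi)) / real (n + 2) = Im (a (n + 1) \<theta>) / real (n + 2)" for \<theta>
      by (simp only: a_per)
  next
    fix r \<theta> :: real
    have "X (r * cis \<theta>) = cis \<theta> * (cnj (cis \<theta>) * X (r * cis \<theta>))"
      by (simp add: cis_cnj cis_mult flip: mult.assoc)
    also have "cnj (cis \<theta>) * X (r * cis \<theta>) =
        Complex (\<Sum>j\<in>J. r ^ j * Re (a j \<theta>)) (r + (\<Sum>j\<in>J. r ^ j * Im (a j \<theta>)))"
      unfolding polar by (simp add: complex_eq_iff flip: of_real_power)
    also have "(\<Sum>j\<in>J. r ^ j * Re (a j \<theta>)) = - (\<Sum>n\<in>(\<lambda>j. j - 1) ` J. r ^ (n + 1) * - Re (a (n + 1) \<theta>))"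
      unfolding reindex[of "\<lambda>j. r ^ j * Re (a j \<theta>)", symmetric] by (simp add: sum_negf)
    also have "(\<Sum>j\<in>J. r ^ j * Im (a j \<theta>)) =
        (\<Sum>n\<in>(\<lambda>j. j - 1) ` J. real (n + 2) * r ^ (n + 1) * (Im (a (n + 1) \<theta>) / real (n + 2)))"
      unfolding reindex[of "\<lambda>j. r ^ j * Im (a j \<theta>)", symmetric]
      by (intro sum.cong) (auto simp del: of_nat_add)
    finally show "X (r * cis \<theta>) = cis \<theta> * Complex
        (- (\<Sum>n\<in>(\<lambda>j. j - 1) ` J. r ^ (n + 1) * - Re (a (n + 1) \<theta>)))
        (r + (\<Sum>n\<in>(\<lambda>j. j - 1) ` J. real (n + 2) * r ^ (n + 1) * (Im (a (n + 1) \<theta>) / real (n + 2))))" .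
  qed
qed

text \<open>
  The lowest nonzero homogeneous part decides. Its angular factor in the Hamiltonian does not vanish
  identically: otherwise its derivative vanishes too, and the two together determine this part of the
  field on the unit circle.
\<close>

theorem nonisochronous_if_degree_gaps:
  fixes p :: "int \<Rightarrow> nat \<Rightarrow> complex" and J :: "nat set"
  assumes fin: "finite J" and J: "\<And>j. j \<in> J \<Longrightarrow> 2 \<le> j" and gaps: "\<And>j. j \<in> J \<Longrightarrow> 2 * j - 1 \<notin> J"
    and X: "X = (\<lambda>x. lin_field x + (\<Sum>j\<in>J. hom_field p j x))"
    and ham: "real_hamiltonian X" and nontrivial: "X \<noteq> lin_field"
  shows "nonisochronous X"
proof -
  define K where "K = {j \<in> J. hom_field p j \<noteq> (\<lambda>_. 0)}"
  define k where "k = Min K"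
  have "(\<Sum>j\<in>K. hom_field p j x) = (\<Sum>j\<in>J. hom_field p j x)" for x
    by (rule sum.mono_neutral_left) (use fin in \<open>auto simp: K_def\<close>)
  then have X_K: "X = (\<lambda>x. lin_field x + (\<Sum>j\<in>K. hom_field p j x))"
    by (simp add: X)
  have "finite K" using fin by (simp add: K_def)
  moreover have "K \<noteq> {}" using X_K nontrivial by auto
  ultimately have k: "k \<in> K" "\<And>j. j \<in> K \<Longrightarrow> k \<le> j"
    by (simp_all add: k_def)
  have k2: "2 \<le> k" using k(1) J by (simp add: K_def)
  define a where "a j \<theta> = cnj (cis \<theta>) * hom_field p j (cis \<theta>)" for j \<theta>
  interpret polar_field X "(\<lambda>j. j - 1) ` K"
      "\<lambda>n \<theta>. Im (a (n + 1) \<theta>) / real (n + 2)" "\<lambda>n \<theta>. - Re (a (n + 1) \<theta>)"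
    unfolding a_def
    by (rule polar_field_if_real_hamiltonian[OF \<open>finite K\<close> _ X_K ham]) (simp add: K_def J)
  have min: "k - 1 \<in> (\<lambda>j. j - 1) ` K" using k(1) by blast
  have k_eq: "k - 1 + 1 = k" using k2 by simp
  have "\<exists>\<theta>. Im (a (k - 1 + 1) \<theta>) / real (k - 1 + 2) \<noteq> 0"
  proof (rule ccontr)
    assume "\<not> ?thesis"
    then have zero: "Im (a (k - 1 + 1) \<theta>) / real (k - 1 + 2) = 0" for \<theta> by blast
    have "a k \<theta> = 0" for \<theta>
    proof -
      have "((\<lambda>\<theta>. 0) has_real_derivative - Re (a (k - 1 + 1) \<theta>)) (at \<theta>)"
        using f_deriv[OF min, of \<theta>] unfolding zero .
      from DERIV_unique[OF this DERIV_const] zero[of \<theta>] show ?thesis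
        unfolding k_eq by (simp add: complex_eq_iff)
    qed
    then have cis: "hom_field p k (cis \<theta>) = 0" for \<theta>
      by (simp add: a_def)
    have "hom_field p k x = 0" for x
    proof -
      have "x = of_real (cmod x) * cis (Arg x)"
        using rcis_cmod_Arg[of x] by (simp add: rcis_def)
      then have "hom_field p k x = of_real (cmod x) ^ k * hom_field p k (cis (Arg x))"
        using hom_field_scale[of p k "cmod x" "cis (Arg x)"] by simp
      then show ?thesis by (simp add: cis)
    qed
    with k(1) show False by (auto simp: K_def)
  qed
  then obtain \<theta>\<^sub>0 where "Im (a (k - 1 + 1) \<theta>\<^sub>0) / real (k - 1 + 2) \<noteq> 0" ..
  moreover have "2 * (k - 1) \<notin> (\<lambda>j. j - 1) ` K"
  proof
    assume "2 * (k - 1) \<in> (\<lambda>j. j - 1) ` K"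
    then obtain j where j: "2 * (k - 1) = j - 1" "j \<in> J" by (auto simp: K_def)
    then have "j = 2 * k - 1" using J[of j] k2 by linarith
    with j gaps[of k] k(1) show False by (simp add: K_def)
  qed
  moreover have "k - 1 \<le> n" if "n \<in> (\<lambda>j. j - 1) ` K" for n
    using that k(2) by (auto intro: diff_le_mono)
  ultimately show ?thesis
    using nonisochronous_if_gap[OF min] by blast
qed

section \<open>Gaps between the blocks of degrees\<close>

theorem theorem3:
  fixes k l :: int and m :: nat and c :: "nat \<Rightarrow> int"
    and p :: "int \<Rightarrow> nat \<Rightarrow> complex" and X :: "complex \<Rightarrow> complex"
  assumes "k \<ge> 2" and "l \<le> k - 1" and "m \<ge> 1"
    and "c 1 = 4 * l"
    and "\<And>n. n \<ge> 2 \<Longrightarrow> c n = 4 * (c (n - 1) - 1)"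
    and "X = (\<lambda>x. lin_field x + (\<Sum>r=k..2*l. hom_field p (nat r) x)
                 + (\<Sum>n=1..m. \<Sum>j=c n..2*(c n - 1). hom_field p (nat j) x))"
    and "real_hamiltonian X"
    and "X \<noteq> lin_field"
  shows "nonisochronous X"
proof -
  have c_Suc: "c (Suc n) = 4 * (c n - 1)" if "n \<ge> 1" for n
    using assms(5)[of "Suc n"] that by simp
  \<comment> \<open>For \<open>l \<le> 0\<close> all blocks are empty and the field is linear.\<close>
  have l: "l \<ge> 1"
  proof (rule ccontr)
    assume "\<not> l \<ge> 1"
    have "c n \<le> 0" if "n \<ge> 1" for n
      using that by (induction n rule: dec_induct) (use assms(4) c_Suc \<open>\<not> l \<ge> 1\<close> in auto)
    then have "{c n..2 * (c n - 1)} = {}" if "n \<ge> 1" for n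
      using that by force
    moreover have "{k..2 * l} = {}" using assms(1) \<open>\<not> l \<ge> 1\<close> by simp
    ultimately show False using assms(6,8) by simp
  qed
  have c_ge: "c n \<ge> 4 * l" if "n \<ge> 1" for n
    using that by (induction n rule: dec_induct) (use assms(4) c_Suc l in auto)
  \<comment> \<open>A later block starts no earlier than twice the end of block \<open>n\<close>, so that \<open>2 r - 1\<close> stays below it.\<close>
  have c_gap: "4 * (c n - 1) \<le> c n'" if "1 \<le> n" "n < n'" for n n'
  proof -
    have "Suc n \<le> n'" using that by simp
    then show ?thesis
    proof (induction n' rule: dec_induct)
      case base
      then show ?case using c_Suc that by simp
    next
      case (step i)
      then show ?case using c_Suc[of i] c_ge[of i] l that by simp
    qed
  qed
  define B where "B n = {c n..2 * (c n - 1)}" for n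
  define I where "I = {k..2*l} \<union> (\<Union>n\<in>{1..m}. B n)"
  have low: "2 * c n - 1 \<le> 2 * r - 1" "2 * r - 1 < 4 * (c n - 1)" if "r \<in> B n" for r n
    using that by (auto simp: B_def)
  have I2: "2 \<le> r" if "r \<in> I" for r
    using that assms(1) l c_ge by (force simp: I_def B_def)
  have I_gaps: "2 * r - 1 \<notin> I" if "r \<in> I" for r
  proof
    assume "2 * r - 1 \<in> I"
    then consider "2 * r - 1 \<le> 2 * l" | n' where "1 \<le> n'" "2 * r - 1 \<in> B n'"
      by (auto simp: I_def)
    note double = this
    from \<open>r \<in> I\<close> consider "k \<le> r" "r \<le> 2 * l" | n where "1 \<le> n" "r \<in> B n"
      by (auto simp: I_def)
    then show False
    proof cases
      case 1
      from double show False
      proof cases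
        case 1
        then show ?thesis using \<open>k \<le> r\<close> assms(2) by simp
      next
        case (2 n')
        then show ?thesis using \<open>r \<le> 2 * l\<close> c_ge[of n'] by (simp add: B_def)
      qed
    next
      case (2 n)
      from double show False
      proof cases
        case 1
        then show ?thesis using low[OF 2(2)] c_ge[OF 2(1)] l by linarith
      next
        case n': (2 n')
        have "c n' \<le> 2 * r - 1" "2 * r - 1 \<le> 2 * (c n' - 1)"
          using n'(2) by (auto simp: B_def)
        then show ?thesis
          using low[OF 2(2)] c_gap[of n n'] c_gap[of n' n] c_ge[of n] c_ge[of n'] 2(1) n'(1) l
          by (cases n n' rule: linorder_cases) auto
      qed
    qed
  qed
  have "finite I" by (simp add: I_def B_def)
  have sum_I: "(\<Sum>r\<in>I. w r) = (\<Sum>r=k..2*l. w r) + (\<Sum>n=1..m. \<Sum>j=c n..2*(c n - 1). w j)"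
    for w :: "int \<Rightarrow> complex"
  proof -
    have "{k..2*l} \<inter> (\<Union>n\<in>{1..m}. B n) = {}"
      using c_ge l by (force simp: B_def)
    then have "(\<Sum>r\<in>I. w r) = (\<Sum>r=k..2*l. w r) + (\<Sum>r\<in>(\<Union>n\<in>{1..m}. B n). w r)"
      unfolding I_def by (intro sum.union_disjoint) (auto simp: B_def)
    also have "(\<Sum>r\<in>(\<Union>n\<in>{1..m}. B n). w r) = (\<Sum>n=1..m. \<Sum>r\<in>B n. w r)"
    proof (intro sum.UNION_disjoint ballI impI)
      fix n n' assume n: "n \<in> {1..m}" "n' \<in> {1..m}" "n \<noteq> n'"
      show "B n \<inter> B n' = {}"
        using c_gap[of n n'] c_gap[of n' n] c_ge[of n] c_ge[of n'] n l
        by (cases n n' rule: linorder_cases) (auto simp: B_def)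
    qed (auto simp: B_def)
    finally show ?thesis by (simp add: B_def)
  qed
  have inj: "inj_on nat I"
    using I2 by (intro inj_onI) (metis int_nat_eq linorder_not_le order_trans zero_le_numeral)
  show ?thesis
  proof (rule nonisochronous_if_degree_gaps[of "nat ` I" X p])
    show "X = (\<lambda>x. lin_field x + (\<Sum>j\<in>nat ` I. hom_field p j x))"
      unfolding assms(6) sum.reindex[OF inj] o_def sum_I by (simp add: add.assoc)
    show "finite (nat ` I)" using \<open>finite I\<close> by simp
    show "2 \<le> j" if "j \<in> nat ` I" for j using that I2 by force
    show "2 * j - 1 \<notin> nat ` I" if "j \<in> nat ` I" for j
    proof
      assume "2 * j - 1 \<in> nat ` I"
      then obtain r r' where r: "r \<in> I" "j = nat r" "r' \<in> I" "2 * j - 1 = nat r'"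
        using \<open>j \<in> nat ` I\<close> by auto
      then have "r' = 2 * r - 1" using I2[of r] I2[of r'] by linarith
      with r I_gaps show False by blast
    qed
  qed (use assms in auto)
qed

end
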